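(* A graph product $(G,P)=\Gamma_{I\in\Lambda}(G_I,P_I)$ of weakly quasi-lattice ordered groups is a weakly quasi-lattice ordered group. In particular, if $x,y\in P$ have a common upper bound in $P$ and $I$ is any vertex in $\Lambda$, then, writing $x=x_Ix'$ and $y=y_Iy'$, we have $$x\vee y=(x_I\vee y_I)(x'\vee y'),$$ and every vertex on $x'\vee y'$ is a vertex on $x'$ or on $y'$.
   Context: Let $G$ be a discrete group with a unital subsemigroup $P$ such that $P\cap P^{-1}=\{e\}$ (a partially ordered group $(G,P)$ with positive cone $P$). The left-invariant partial order is $x\le y$ iff $x^{-1}y\in P$. $(G,P)$ is weakly quasi-lattice ordered if any $x,y\in P$ with a common upper bound in $P$ have a least common upper bound in $P$, denoted $x\vee y$. Graph products. Let $\Gamma$ be a (simple, undirected) graph with vertex set $\Lambda$; distinct vertices $I,J$ are adjacent if $\{I,J\}$ is an edge. For a family of groups $\{G_I\}_{I\in\Lambda}$, the graph product $G=\Gamma_{I\in\Lambda}G_I$ is the quotient of the free product of the $G_I$ by the smallest normal subgroup containing $x_1x_2x_1^{-1}x_2^{-1}$ for all $x_1\in G_I$, $x_2\in G_J$ with $I,J$ adjacent. It is generated by $\bigsqcup_I G_I\setminus\{e\}$; for a generator $x$, $I(x)$ is the unique vertex with $x\in G_{I(x)}$. An expression for $x\in G$ is a word $x_1\cdots x_l$ in these generators equal to $x$. A shuffle replaces a subexpression $x_ix_{i+1}$ by $x_{i+1}x_i$ when $I(x_i),I(x_{i+1})$ are adjacent; an amalgamation replaces $x_ix_{i+1}$ with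 $I(x_i)=I(x_{i+1})$ by the single product. An expression is reduced if its length cannot be decreased by finitely many shuffles and amalgamations. The vertices on $x$ are the vertices $I(x_i)$ occurring in a reduced expression $x_1\cdots x_l$ of $x$. An initial vertex on $x$ is a vertex $I$ such that some reduced expression $x_1\cdots x_l$ of $x$ contains a generator $x_i\in G_I$ with $I(x_i)$ adjacent to $I(x_j)$ for all $j<i$; in that case $x_I:=x_i$. If $I$ is not an initial vertex on $x$, put $x_I:=e$. In either case $x'$ is defined by $x=x_Ix'$ (and similarly $y=y_Iy'$). If each $(G_I,P_I)$ is partially ordered with positive cone $P_I$, an element $x$ is positive if it has a reduced expression $x_1\cdots x_l$ with $x_i\in P_{I(x_i)}$ for all $i$; $P$ is the subsemigroup of $G$ of positive elements (including $e$), and $(G,P)=\Gamma_{I\in\Lambda}(G_I,P_I)$ is a partially ordered group. *)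

theory Defs
  imports "HOL-Algebra.Algebra"
begin

section \<open>Partially ordered groups and weak quasi-lattice order\<close>

locale partially_ordered_group = group G for G (structure) +
  fixes P :: "'a set"
  assumes submonoid_cone: "submonoid P G"
    and cone_Int_inv: "P \<inter> set_inv P = {\<one>}"

text \<open>The left-invariant order, restricted to the positive cone. Taking the carrier to be the cone
  means that \<^const>\<open>Upper\<close>, \<^const>\<open>least\<close> and \<^const>\<open>join\<close> refer to (least) upper bounds lying
  in the cone.\<close>

definition cone_order :: "('a, 'b) monoid_scheme \<Rightarrow> 'a set \<Rightarrow> 'a gorder"
  where "cone_order G P =
    \<lparr>carrier = P, eq = (=), le = (\<lambda>x y. inv\<^bsub>G\<^esub> x \<otimes>\<^bsub>G\<^esub> y \<in> P)\<rparr>"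

locale weakly_quasi_lattice_ordered_group = partially_ordered_group +
  assumes ex_least_upper_bound:
    "\<lbrakk>x \<in> P; y \<in> P; Upper (cone_order G P) {x, y} \<noteq> {}\<rbrakk>
      \<Longrightarrow> \<exists>z. least (cone_order G P) z (Upper (cone_order G P) {x, y})"


section \<open>Simple graphs\<close>

definition simple_graph :: "'v set \<Rightarrow> 'v set set \<Rightarrow> bool"
  where "simple_graph V E \<longleftrightarrow> (\<forall>e\<in>E. \<exists>I\<in>V. \<exists>J\<in>V. I \<noteq> J \<and> e = {I, J})"

definition adjacent :: "'v set set \<Rightarrow> 'v \<Rightarrow> 'v \<Rightarrow> bool"
  where "adjacent E I J \<longleftrightarrow> I \<noteq> J \<and> {I, J} \<in> E"


section \<open>Free products\<close>

text \<open>A word is a list of letters \<open>(I, g)\<close>, where \<open>(I, g)\<close> stands for the element \<open>g\<close> of the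
  group at the vertex \<open>I\<close>; so the groups are treated as disjoint even though their carriers are
  subsets of one type.\<close>

definition all_words :: "'v set \<Rightarrow> ('v \<Rightarrow> ('a, 'b) monoid_scheme) \<Rightarrow> ('v \<times> 'a) list set"
  where "all_words V G = lists (SIGMA I:V. carrier (G I))"

inductive free_step ::
  "'v set \<Rightarrow> ('v \<Rightarrow> ('a, 'b) monoid_scheme) \<Rightarrow> ('v \<times> 'a) list \<Rightarrow> ('v \<times> 'a) list \<Rightarrow> bool"
  for V G where
  mult: "\<lbrakk>I \<in> V; g \<in> carrier (G I); h \<in> carrier (G I)\<rbrakk>
    \<Longrightarrow> free_step V G (us @ [(I, g), (I, h)] @ vs) (us @ [(I, g \<otimes>\<^bsub>G I\<^esub> h)] @ vs)"
| one: "I \<in> V \<Longrightarrow> free_step V G (us @ [(I, \<one>\<^bsub>G I\<^esub>)] @ vs) (us @ vs)"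

definition free_rel ::
  "'v set \<Rightarrow> ('v \<Rightarrow> ('a, 'b) monoid_scheme) \<Rightarrow> (('v \<times> 'a) list \<times> ('v \<times> 'a) list) set"
  where "free_rel V G =
    {(u, v). u \<in> all_words V G \<and> v \<in> all_words V G \<and> equivclp (free_step V G) u v}"

definition free_product ::
  "'v set \<Rightarrow> ('v \<Rightarrow> ('a, 'b) monoid_scheme) \<Rightarrow> ('v \<times> 'a) list set monoid"
  where "free_product V G =
    \<lparr>carrier = all_words V G // free_rel V G,
     monoid.mult = (\<lambda>A B. \<Union>u\<in>A. \<Union>v\<in>B. free_rel V G `` {u @ v}),
     monoid.one = free_rel V G `` {[]}\<rparr>"

definition free_incl ::
  "'v set \<Rightarrow> ('v \<Rightarrow> ('a, 'b) monoid_scheme) \<Rightarrow> 'v \<Rightarrow> 'a \<Rightarrow> ('v \<times> 'a) list set"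
  where "free_incl V G I g = free_rel V G `` {[(I, g)]}"


section \<open>Graph products\<close>

definition normal_closure :: "('a, 'b) monoid_scheme \<Rightarrow> 'a set \<Rightarrow> 'a set"
  where "normal_closure G S = \<Inter> {N. N \<lhd> G \<and> S \<subseteq> N}"

definition edge_commutators ::
  "'v set \<Rightarrow> 'v set set \<Rightarrow> ('v \<Rightarrow> ('a, 'b) monoid_scheme) \<Rightarrow> ('v \<times> 'a) list set set"
  where "edge_commutators V E G =
    (let F = free_product V G; \<iota> = free_incl V G in
      {\<iota> I g \<otimes>\<^bsub>F\<^esub> \<iota> J h \<otimes>\<^bsub>F\<^esub> inv\<^bsub>F\<^esub> (\<iota> I g) \<otimes>\<^bsub>F\<^esub> inv\<^bsub>F\<^esub> (\<iota> J h) | I J g h.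
        I \<in> V \<and> J \<in> V \<and> adjacent E I J \<and> g \<in> carrier (G I) \<and> h \<in> carrier (G J)})"

definition graph_kernel ::
  "'v set \<Rightarrow> 'v set set \<Rightarrow> ('v \<Rightarrow> ('a, 'b) monoid_scheme) \<Rightarrow> ('v \<times> 'a) list set set"
  where "graph_kernel V E G = normal_closure (free_product V G) (edge_commutators V E G)"

definition graph_product ::
  "'v set \<Rightarrow> 'v set set \<Rightarrow> ('v \<Rightarrow> ('a, 'b) monoid_scheme) \<Rightarrow> ('v \<times> 'a) list set set monoid"
  where "graph_product V E G = free_product V G Mod graph_kernel V E G"

definition vertex_incl ::
  "'v set \<Rightarrow> 'v set set \<Rightarrow> ('v \<Rightarrow> ('a, 'b) monoid_scheme) \<Rightarrow> 'v \<Rightarrow> 'a \<Rightarrow> ('v \<times> 'a) list set set"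
  where "vertex_incl V E G I g = graph_kernel V E G #>\<^bsub>free_product V G\<^esub> free_incl V G I g"


section \<open>Expressions\<close>

definition generator_words :: "'v set \<Rightarrow> ('v \<Rightarrow> ('a, 'b) monoid_scheme) \<Rightarrow> ('v \<times> 'a) list set"
  where "generator_words V G = lists (SIGMA I:V. carrier (G I) - {\<one>\<^bsub>G I\<^esub>})"

definition word_value ::
  "'v set \<Rightarrow> 'v set set \<Rightarrow> ('v \<Rightarrow> ('a, 'b) monoid_scheme) \<Rightarrow> ('v \<times> 'a) list \<Rightarrow> ('v \<times> 'a) list set set"
  where "word_value V E G w =
    foldr (\<lambda>(I, g) x. vertex_incl V E G I g \<otimes>\<^bsub>graph_product V E G\<^esub> x) w \<one>\<^bsub>graph_product V E G\<^esub>"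

definition expression ::
  "'v set \<Rightarrow> 'v set set \<Rightarrow> ('v \<Rightarrow> ('a, 'b) monoid_scheme)
    \<Rightarrow> ('v \<times> 'a) list set set \<Rightarrow> ('v \<times> 'a) list \<Rightarrow> bool"
  where "expression V E G x w \<longleftrightarrow> w \<in> generator_words V G \<and> word_value V E G w = x"

text \<open>Identity elements are not generators, so an amalgamation whose product is trivial deletes
  both letters.\<close>

inductive word_step ::
  "'v set set \<Rightarrow> ('v \<Rightarrow> ('a, 'b) monoid_scheme) \<Rightarrow> ('v \<times> 'a) list \<Rightarrow> ('v \<times> 'a) list \<Rightarrow> bool"
  for E G where
  shuffle: "adjacent E I J
    \<Longrightarrow> word_step E G (us @ [(I, g), (J, h)] @ vs) (us @ [(J, h), (I, g)] @ vs)"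
| amalgamate: "g \<otimes>\<^bsub>G I\<^esub> h \<noteq> \<one>\<^bsub>G I\<^esub>
    \<Longrightarrow> word_step E G (us @ [(I, g), (I, h)] @ vs) (us @ [(I, g \<otimes>\<^bsub>G I\<^esub> h)] @ vs)"
| cancel: "g \<otimes>\<^bsub>G I\<^esub> h = \<one>\<^bsub>G I\<^esub>
    \<Longrightarrow> word_step E G (us @ [(I, g), (I, h)] @ vs) (us @ vs)"

definition reduced_expression ::
  "'v set \<Rightarrow> 'v set set \<Rightarrow> ('v \<Rightarrow> ('a, 'b) monoid_scheme)
    \<Rightarrow> ('v \<times> 'a) list set set \<Rightarrow> ('v \<times> 'a) list \<Rightarrow> bool"
  where "reduced_expression V E G x w \<longleftrightarrow>
    expression V E G x w \<and> (\<forall>w'. (word_step E G)\<^sup>*\<^sup>* w w' \<longrightarrow> length w \<le> length w')"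

definition vertices_on ::
  "'v set \<Rightarrow> 'v set set \<Rightarrow> ('v \<Rightarrow> ('a, 'b) monoid_scheme) \<Rightarrow> ('v \<times> 'a) list set set \<Rightarrow> 'v set"
  where "vertices_on V E G x = {I. \<exists>w. reduced_expression V E G x w \<and> I \<in> fst ` set w}"

definition initial_letter ::
  "'v set \<Rightarrow> 'v set set \<Rightarrow> ('v \<Rightarrow> ('a, 'b) monoid_scheme)
    \<Rightarrow> 'v \<Rightarrow> ('v \<times> 'a) list set set \<Rightarrow> 'a \<Rightarrow> bool"
  where "initial_letter V E G I x g \<longleftrightarrow>
    (\<exists>w i. reduced_expression V E G x w \<and> i < length w \<and> w ! i = (I, g) \<and>
      (\<forall>j<i. adjacent E I (fst (w ! j))))"

definition initial_vertex ::
  "'v set \<Rightarrow> 'v set set \<Rightarrow> ('v \<Rightarrow> ('a, 'b) monoid_scheme)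
    \<Rightarrow> 'v \<Rightarrow> ('v \<times> 'a) list set set \<Rightarrow> bool"
  where "initial_vertex V E G I x \<longleftrightarrow> (\<exists>g. initial_letter V E G I x g)"

text \<open>The factors of \<open>x = x\<^sub>I x'\<close>. The initial letter at \<open>I\<close>, if any, does not depend on the reduced
  expression, which justifies the definite description.\<close>

definition initial_part ::
  "'v set \<Rightarrow> 'v set set \<Rightarrow> ('v \<Rightarrow> ('a, 'b) monoid_scheme)
    \<Rightarrow> 'v \<Rightarrow> ('v \<times> 'a) list set set \<Rightarrow> ('v \<times> 'a) list set set"
  where "initial_part V E G I x =
    (if initial_vertex V E G I x
     then vertex_incl V E G I (THE g. initial_letter V E G I x g)
     else \<one>\<^bsub>graph_product V E G\<^esub>)"

definition remaining_part ::
  "'v set \<Rightarrow> 'v set set \<Rightarrow> ('v \<Rightarrow> ('a, 'b) monoid_scheme)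
    \<Rightarrow> 'v \<Rightarrow> ('v \<times> 'a) list set set \<Rightarrow> ('v \<times> 'a) list set set"
  where "remaining_part V E G I x =
    inv\<^bsub>graph_product V E G\<^esub> (initial_part V E G I x) \<otimes>\<^bsub>graph_product V E G\<^esub> x"

definition graph_product_cone ::
  "'v set \<Rightarrow> 'v set set \<Rightarrow> ('v \<Rightarrow> ('a, 'b) monoid_scheme) \<Rightarrow> ('v \<Rightarrow> 'a set)
    \<Rightarrow> ('v \<times> 'a) list set set set"
  where "graph_product_cone V E G P =
    {x. \<exists>w. reduced_expression V E G x w \<and> (\<forall>(I, g)\<in>set w. g \<in> P I)}"

end

(* The normal form theorem is proved by van der Waerden's trick: a letter (I, g) acts on reduced
   words up to shuffling by multiplying the initial letter at I by g, and these actions satisfy the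
   defining relations of the graph product. Shuffle equivalence is handled through projections to
   pairs of non-adjacent vertices, which makes it a cancellative congruence by definition.

   For the order, let z be an upper bound of x and I a vertex. Either every vertex on x' is adjacent
   to I, so that x' commutes with the elements at I, or some letter of x' permanently screens off I
   from anything multiplied on the right, so that z_I = x_I. In both cases x_I <= z_I and x' <= z',
   and (x_I v y_I)(x' v y') is a least upper bound of x and y as soon as the vertices on x' v y' lie
   on x' or y'. Existence of least upper bounds, together with this condition on the vertices,
   follows by induction on the length of x, taking I to be its first letter. *)

theory Submission
  imports Defs
begin

text \<open>The obstacle is that \<open>z_I\<close> may strictly exceed
  \<open>s = x_I \<or> y_I\<close>. Put \<open>t = x' \<or> y'\<close>, \<open>z_I = s r\<close> and
  \<open>z' = t q\<close>. Then \<open>z = s r t q\<close>, which is a right multiple of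
  \<open>s t\<close> once \<open>r\<close> can pass \<open>t\<close>. If \<open>r\<close> is
  nontrivial, \<open>z_I\<close> differs from both \<open>x_I\<close> and \<open>y_I\<close>, so
  every vertex on \<open>x'\<close> and \<open>y'\<close> is adjacent to \<open>I\<close>; this
  carries over to \<open>t\<close> precisely because its vertices lie among theirs. So the condition
  on the vertices is no by-product: it has to be carried through the induction that yields
  existence. Screening is permanent because \<open>P \<inter> P^-1\<close> is trivial in each vertex
  group: a nontrivial positive letter stays nontrivial when it absorbs another positive letter, so
  the letters of the left factor never vanish from a product. Defining shuffle equivalence by
  projections makes cancellation immediate. The price is that shuffle equivalent words having the
  same value is no longer a matter of swapping neighbours and is proved separately, in
  \<open>word_value_cong\<close>.\<close>

section \<open>Words up to shuffling\<close>

text \<open>Taking \<open>I = J\<close> is allowed, so the letters at a single vertex keep their order.\<close>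
definition shuffle_eq :: "'v set set \<Rightarrow> ('v \<times> 'a) list \<Rightarrow> ('v \<times> 'a) list \<Rightarrow> bool"
  where "shuffle_eq E u w \<longleftrightarrow>
    (\<forall>I J. \<not> adjacent E I J \<longrightarrow> filter (\<lambda>x. fst x \<in> {I, J}) u = filter (\<lambda>x. fst x \<in> {I, J}) w)"

text \<open>On reduced words this computes the initial letter at \<open>I\<close> of the value, as
  \<open>initial_letter_iff\<close> shows; no search through all reduced expressions is
  involved.\<close>

primrec first_letter :: "'v set set \<Rightarrow> 'v \<Rightarrow> ('v \<times> 'a) list \<Rightarrow> 'a option"
  where
    "first_letter E I [] = None"
  | "first_letter E I (x # w) =
      (if fst x = I then Some (snd x) else if adjacent E I (fst x) then first_letter E I w else None)"

primrec delete_first :: "'v set set \<Rightarrow> 'v \<Rightarrow> ('v \<times> 'a) list \<Rightarrow> ('v \<times> 'a) list"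
  where
    "delete_first E I [] = []"
  | "delete_first E I (x # w) =
      (if fst x = I then w else if adjacent E I (fst x) then x # delete_first E I w else x # w)"

lemma adjacent_irrefl [simp]: "\<not> adjacent E I I"
  by (simp add: adjacent_def)

lemma adjacent_sym: "adjacent E I J \<Longrightarrow> adjacent E J I"
  by (auto simp: adjacent_def insert_commute)

lemma shuffle_eq_refl [simp]: "shuffle_eq E w w"
  by (simp add: shuffle_eq_def)

lemma shuffle_eq_sym: "shuffle_eq E u w \<Longrightarrow> shuffle_eq E w u"
  by (simp add: shuffle_eq_def)

lemma shuffle_eq_trans [trans]: "shuffle_eq E u v \<Longrightarrow> shuffle_eq E v w \<Longrightarrow> shuffle_eq E u w"
  by (simp add: shuffle_eq_def)

lemma shuffle_eq_append_cancel [simp]: "shuffle_eq E (v @ u) (v @ w) \<longleftrightarrow> shuffle_eq E u w"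
  by (simp add: shuffle_eq_def)

lemma shuffle_eq_Cons_cancel [simp]: "shuffle_eq E (x # u) (x # w) \<longleftrightarrow> shuffle_eq E u w"
  using shuffle_eq_append_cancel[of E "[x]"] by simp

lemma shuffle_eq_swap:
  assumes "adjacent E (fst x) (fst y)"
  shows "shuffle_eq E (x # y # w) (y # x # w)"
  using assms adjacent_sym[OF assms] by (auto simp: shuffle_eq_def)

text \<open>A vertex is not adjacent to itself, so the projection to the single vertex of
  \<open>x\<close> already fixes the multiplicity of \<open>x\<close>.\<close>

lemma shuffle_eq_mset:
  assumes "shuffle_eq E u w"
  shows "mset u = mset w"
proof (rule multiset_eqI)
  fix x
  have "filter (\<lambda>y. x = y) u = filter (\<lambda>y. x = y) (filter (\<lambda>y. fst y \<in> {fst x, fst x}) u)"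
    for u :: "('a \<times> 'b) list"
    by (auto intro: filter_cong)
  moreover have "filter (\<lambda>y. fst y \<in> {fst x, fst x}) u = filter (\<lambda>y. fst y \<in> {fst x, fst x}) w"
    using assms unfolding shuffle_eq_def by (metis adjacent_irrefl)
  ultimately have "filter (\<lambda>y. x = y) u = filter (\<lambda>y. x = y) w"
    by metis
  then show "count (mset u) x = count (mset w) x"
    by (simp add: count_mset count_list_eq_length_filter)
qed

lemma shuffle_eq_set: "shuffle_eq E u w \<Longrightarrow> set u = set w"
  by (metis shuffle_eq_mset set_mset_mset)

lemma shuffle_eq_length: "shuffle_eq E u w \<Longrightarrow> length u = length w"
  by (metis shuffle_eq_mset size_mset)

lemma shuffle_eq_Nil [simp]: "shuffle_eq E w [] \<longleftrightarrow> w = []" "shuffle_eq E [] w \<longleftrightarrow> w = []"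
  by (auto dest: shuffle_eq_length)

text \<open>A letter at \<open>I\<close> can be brought to the front exactly if no letter at a
  vertex \<open>J\<close> not adjacent to \<open>I\<close> precedes it, and the projection to
  \<open>{I, J}\<close> detects this. The right-hand side mentions only the projections that define
  \<open>shuffle_eq\<close>, so invariance follows at once.\<close>

lemma first_letter_eq_Some_iff:
  "first_letter E I w = Some g \<longleftrightarrow>
    (\<forall>J. \<not> adjacent E I J \<longrightarrow> (\<exists>v. filter (\<lambda>x. fst x \<in> {I, J}) w = (I, g) # v))"
proof (induction w)
  case Nil
  then show ?case by (auto intro: exI[of _ I])
next
  case (Cons x w)
  consider "fst x = I" | "fst x \<noteq> I" "adjacent E I (fst x)" | "fst x \<noteq> I" "\<not> adjacent E I (fst x)"
    by blast
  then show ?case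
  proof cases
    case 1
    then show ?thesis by (cases x) (auto intro: exI[of _ I])
  next
    case 2
    then show ?thesis using Cons by auto
  next
    case 3
    then show ?thesis by (auto intro!: exI[of _ "fst x"])
  qed
qed

lemma first_letter_cong:
  assumes "shuffle_eq E u w"
  shows "first_letter E I u = first_letter E I w"
proof -
  have "first_letter E I u = Some g \<longleftrightarrow> first_letter E I w = Some g" for g
    using assms by (simp add: first_letter_eq_Some_iff shuffle_eq_def)
  then show ?thesis by (metis not_Some_eq)
qed

lemma delete_first_None: "first_letter E I w = None \<Longrightarrow> delete_first E I w = w"
  by (induction w) (auto split: if_splits)

lemma shuffle_eq_first_letter:
  "first_letter E I w = Some g \<Longrightarrow> shuffle_eq E w ((I, g) # delete_first E I w)"
proof (induction w)
  case (Cons x w)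
  show ?case
  proof (cases "fst x = I")
    case True
    then show ?thesis using Cons.prems by (cases x) auto
  next
    case False
    then have adj: "adjacent E I (fst x)" and "first_letter E I w = Some g"
      using Cons.prems by (auto split: if_splits)
    then have "shuffle_eq E (x # w) (x # (I, g) # delete_first E I w)"
      using Cons.IH by simp
    also have "shuffle_eq E \<dots> ((I, g) # x # delete_first E I w)"
      by (rule shuffle_eq_swap) (use adj in \<open>simp add: adjacent_sym\<close>)
    finally show ?thesis using False adj by simp
  qed
qed simp

lemma first_letter_mem: "first_letter E I w = Some g \<Longrightarrow> (I, g) \<in> set w"
  using shuffle_eq_set[OF shuffle_eq_first_letter] by fastforce

lemma set_delete_first_subset: "set (delete_first E I w) \<subseteq> set w"
  by (induction w) auto

text \<open>With the initial letter in front, both words have the same leading letter, which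
  cancels.\<close>

lemma delete_first_cong:
  assumes "shuffle_eq E u w"
  shows "shuffle_eq E (delete_first E I u) (delete_first E I w)"
proof (cases "first_letter E I u")
  case None
  then show ?thesis
    using assms first_letter_cong[OF assms, of I] by (simp add: delete_first_None)
next
  case (Some g)
  then have "shuffle_eq E ((I, g) # delete_first E I u) ((I, g) # delete_first E I w)"
    using first_letter_cong[OF assms, of I] assms
    by (metis shuffle_eq_first_letter shuffle_eq_sym shuffle_eq_trans)
  then show ?thesis by simp
qed

lemma first_letter_delete_first_adjacent:
  "adjacent E I J \<Longrightarrow> first_letter E I (delete_first E J w) = first_letter E I w"
  by (induction w) auto

lemma delete_first_commute:
  "adjacent E I J \<Longrightarrow> delete_first E I (delete_first E J w) = delete_first E J (delete_first E I w)"
  by (induction w) (auto simp: adjacent_sym)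

lemma first_letter_append_adjacent:
  "\<forall>x\<in>set u. adjacent E I (fst x) \<Longrightarrow> first_letter E I (u @ w) = first_letter E I w"
  by (induction u) auto

lemma first_letter_split:
  "first_letter E I w = Some g \<Longrightarrow>
    \<exists>u v. w = u @ (I, g) # v \<and> delete_first E I w = u @ v \<and> (\<forall>x\<in>set u. adjacent E I (fst x))"
proof (induction w)
  case (Cons x w)
  show ?case
  proof (cases "fst x = I")
    case True
    then have "x # w = [] @ (I, g) # w" "delete_first E I (x # w) = [] @ w"
      using Cons.prems by (cases x; simp)+
    then show ?thesis by (metis empty_iff empty_set)
  next
    case False
    then have adj: "adjacent E I (fst x)" "first_letter E I w = Some g"
      using Cons.prems by (auto split: if_splits)
    then obtain u v where "w = u @ (I, g) # v" "delete_first E I w = u @ v"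
        "\<forall>x\<in>set u. adjacent E I (fst x)"
      using Cons.IH by blast
    then show ?thesis
      using adj False by (intro exI[of _ "x # u"] exI[of _ v]) simp
  qed
qed simp

lemma word_step_append: "word_step E G u v \<Longrightarrow> word_step E G (a @ u @ b) (a @ v @ b)"
proof (induction rule: word_step.induct)
  case (shuffle I J us g h vs)
  then show ?case using word_step.shuffle[of E I J G "a @ us" g h "vs @ b"] by simp
next
  case (amalgamate g I h us vs)
  then show ?case using word_step.amalgamate[where us = "a @ us" and vs = "vs @ b"] by fastforce
next
  case (cancel g I h us vs)
  then show ?case using word_step.cancel[where us = "a @ us" and vs = "vs @ b"] by fastforce
qed

lemma word_steps_append:
  "(word_step E G)\<^sup>*\<^sup>* u v \<Longrightarrow> (word_step E G)\<^sup>*\<^sup>* (a @ u @ b) (a @ v @ b)"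
  by (induction rule: rtranclp_induct) (auto intro: rtranclp.rtrancl_into_rtrancl word_step_append)

lemma word_steps_move:
  "\<forall>y\<in>set u. adjacent E (fst x) (fst y) \<Longrightarrow> (word_step E G)\<^sup>*\<^sup>* (x # u @ v) (u @ x # v)"
proof (induction u)
  case (Cons y u)
  have "word_step E G (x # y # u @ v) (y # x # u @ v)"
    using word_step.shuffle[of E "fst x" "fst y" G "[]" "snd x" "snd y" "u @ v"] Cons.prems by simp
  moreover have "(word_step E G)\<^sup>*\<^sup>* (y # x # u @ v) (y # u @ x # v)"
    using Cons word_steps_append[of E G "x # u @ v" "u @ x # v" "[y]" "[]"] by simp
  ultimately show ?case by simp
qed simp


section \<open>The normal form theorem for graph products\<close>

locale group_family =
  fixes V :: "'v set" and E :: "'v set set" and G :: "'v \<Rightarrow> ('a, 'b) monoid_scheme"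
  assumes group_at: "I \<in> V \<Longrightarrow> group (G I)"
begin

text \<open>With the identity as default, every reduced word is
  \<open>cons I (head I w) (delete_first E I w)\<close> up to shuffling, so \<open>act\<close> needs
  no case distinction on whether \<open>I\<close> is initial.\<close>

definition head :: "'v \<Rightarrow> ('v \<times> 'a) list \<Rightarrow> 'a"
  where "head I w = (case first_letter E I w of None \<Rightarrow> \<one>\<^bsub>G I\<^esub> | Some g \<Rightarrow> g)"

definition cons :: "'v \<Rightarrow> 'a \<Rightarrow> ('v \<times> 'a) list \<Rightarrow> ('v \<times> 'a) list"
  where "cons I g w = (if g = \<one>\<^bsub>G I\<^esub> then w else (I, g) # w)"

definition act :: "'v \<times> 'a \<Rightarrow> ('v \<times> 'a) list \<Rightarrow> ('v \<times> 'a) list"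
  where "act x w = cons (fst x) (snd x \<otimes>\<^bsub>G (fst x)\<^esub> head (fst x) w) (delete_first E (fst x) w)"

text \<open>A local form of reducedness, suited to structural induction: no letter can be shuffled
  next to a later letter at its own vertex. It agrees with minimality of length by
  \<open>reduced_expression_iff\<close>.\<close>

primrec reduced :: "('v \<times> 'a) list \<Rightarrow> bool"
  where
    "reduced [] \<longleftrightarrow> True"
  | "reduced (x # w) \<longleftrightarrow> fst x \<in> V \<and> snd x \<in> carrier (G (fst x)) - {\<one>\<^bsub>G (fst x)\<^esub>} \<and>
      first_letter E (fst x) w = None \<and> reduced w"

lemma reduced_generator_words: "reduced w \<Longrightarrow> w \<in> generator_words V G"
  by (induction w) (auto simp: generator_words_def)

lemma generator_words_subset: "generator_words V G \<subseteq> all_words V G"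
  unfolding generator_words_def all_words_def by (rule lists_mono) auto

lemma reduced_delete_first: "reduced w \<Longrightarrow> reduced (delete_first E I w)"
  by (induction w) (auto simp: first_letter_delete_first_adjacent adjacent_sym)

lemma first_letter_delete_first: "reduced w \<Longrightarrow> first_letter E I (delete_first E I w) = None"
  by (induction w) auto

text \<open>The recursion for \<open>reduced\<close> depends on the order of the letters, so the
  induction follows \<open>w\<close>: its leading letter is the one that \<open>first_letter\<close>
  finds in \<open>u\<close>, and removing it from both words keeps them equivalent.\<close>

lemma reduced_cong: "reduced u \<Longrightarrow> shuffle_eq E u w \<Longrightarrow> reduced w"
proof (induction w arbitrary: u)
  case (Cons x w)
  obtain I g where x: "x = (I, g)" by fastforce
  have "first_letter E I u = Some g"
    using first_letter_cong[OF Cons.prems(2), of I] x by simp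
  moreover from this have "(I, g) \<in> set u" by (rule first_letter_mem)
  moreover have "u \<in> generator_words V G"
    using Cons.prems(1) by (rule reduced_generator_words)
  moreover have "shuffle_eq E (delete_first E I u) w"
    using delete_first_cong[OF Cons.prems(2), of I] x by simp
  ultimately show ?case
    using Cons.IH[OF reduced_delete_first[OF Cons.prems(1), of I]]
      first_letter_delete_first[OF Cons.prems(1), of I] first_letter_cong x
    by (fastforce simp: generator_words_def)
qed simp

lemma first_letter_carrier:
  assumes "reduced w" "first_letter E I w = Some g"
  shows "I \<in> V" "g \<in> carrier (G I)" "g \<noteq> \<one>\<^bsub>G I\<^esub>"
  using first_letter_mem[OF assms(2)] reduced_generator_words[OF assms(1)]
  by (auto simp: generator_words_def)

lemma head_carrier [simp]: "I \<in> V \<Longrightarrow> reduced w \<Longrightarrow> head I w \<in> carrier (G I)"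
  using group_at by (auto simp: head_def first_letter_carrier group.is_monoid monoid.one_closed split: option.split)

lemma head_eq_one_iff: "reduced w \<Longrightarrow> head I w = \<one>\<^bsub>G I\<^esub> \<longleftrightarrow> first_letter E I w = None"
  by (auto simp: head_def first_letter_carrier split: option.split)

lemma head_cons: "first_letter E I w = None \<Longrightarrow> head I (cons I g w) = g"
  by (simp add: cons_def head_def)

lemma delete_first_cons: "first_letter E I w = None \<Longrightarrow> delete_first E I (cons I g w) = w"
  by (simp add: cons_def delete_first_None)

lemma reduced_cons:
  "reduced w \<Longrightarrow> I \<in> V \<Longrightarrow> g \<in> carrier (G I) \<Longrightarrow> first_letter E I w = None \<Longrightarrow> reduced (cons I g w)"
  by (simp add: cons_def)

lemma head_cons_adjacent: "adjacent E I J \<Longrightarrow> head I (cons J g w) = head I w"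
  by (auto simp: cons_def head_def)

lemma delete_first_cons_adjacent:
  "adjacent E I J \<Longrightarrow> delete_first E I (cons J g w) = cons J g (delete_first E I w)"
  by (auto simp: cons_def)

lemma cons_cong: "shuffle_eq E u w \<Longrightarrow> shuffle_eq E (cons I g u) (cons I g w)"
  by (simp add: cons_def)

lemma cons_head: "shuffle_eq E w (cons I (head I w) (delete_first E I w))" if "reduced w"
  using that by (cases "first_letter E I w")
    (auto simp: cons_def head_def delete_first_None first_letter_carrier shuffle_eq_first_letter)

lemma reduced_act:
  assumes "reduced w" "fst x \<in> V" "snd x \<in> carrier (G (fst x))"
  shows "reduced (act x w)"
  using assms group_at[of "fst x"] unfolding act_def
  by (intro reduced_cons) (simp_all add: reduced_delete_first first_letter_delete_first
      group.is_monoid monoid.m_closed)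

lemma head_cong: "shuffle_eq E u w \<Longrightarrow> head I u = head I w"
  using first_letter_cong by (metis head_def)

lemma act_cong: "shuffle_eq E u w \<Longrightarrow> shuffle_eq E (act x u) (act x w)"
  by (simp add: act_def head_cong cons_cong delete_first_cong)

text \<open>Only an equivalence, because the letter at \<open>I\<close>, if there is one, is moved
  to the front.\<close>

lemma act_one: "reduced w \<Longrightarrow> I \<in> V \<Longrightarrow> shuffle_eq E (act (I, \<one>\<^bsub>G I\<^esub>) w) w"
  using group_at[of I] cons_head[of w I]
  by (simp add: act_def shuffle_eq_sym group.is_monoid)

lemma act_mult:
  assumes "reduced w" "I \<in> V" "g \<in> carrier (G I)" "h \<in> carrier (G I)"
  shows "act (I, g) (act (I, h) w) = act (I, g \<otimes>\<^bsub>G I\<^esub> h) w"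
proof -
  interpret group "G I" using assms by (simp add: group_at)
  show ?thesis
    using assms by (simp add: act_def head_cons delete_first_cons first_letter_delete_first m_assoc)
qed

lemma head_delete_first_adjacent: "adjacent E I J \<Longrightarrow> head I (delete_first E J w) = head I w"
  by (simp add: head_def first_letter_delete_first_adjacent)

lemma head_act_adjacent: "adjacent E I (fst x) \<Longrightarrow> head I (act x w) = head I w"
  by (simp add: act_def head_cons_adjacent head_delete_first_adjacent)

lemma cons_commute: "adjacent E I J \<Longrightarrow> shuffle_eq E (cons I g (cons J h w)) (cons J h (cons I g w))"
  by (simp add: cons_def shuffle_eq_swap)

text \<open>Neither action changes the initial letter at the other vertex, so both sides attach the
  same two letters, in opposite orders, to the same remaining word.\<close>

lemma act_commute:
  assumes "adjacent E (fst x) (fst y)"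
  shows "shuffle_eq E (act x (act y w)) (act y (act x w))"
proof -
  let ?I = "fst x" and ?J = "fst y"
  have adj: "adjacent E ?J ?I" using assms by (rule adjacent_sym)
  have "act x (act y w) = cons ?I (snd x \<otimes>\<^bsub>G ?I\<^esub> head ?I w)
      (cons ?J (snd y \<otimes>\<^bsub>G ?J\<^esub> head ?J w) (delete_first E ?I (delete_first E ?J w)))"
    using assms by (simp add: act_def head_cons_adjacent head_delete_first_adjacent delete_first_cons_adjacent)
  moreover have "act y (act x w) = cons ?J (snd y \<otimes>\<^bsub>G ?J\<^esub> head ?J w)
      (cons ?I (snd x \<otimes>\<^bsub>G ?I\<^esub> head ?I w) (delete_first E ?J (delete_first E ?I w)))"
    using adj by (simp add: act_def head_cons_adjacent head_delete_first_adjacent delete_first_cons_adjacent)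
  ultimately show ?thesis
    using cons_commute[OF assms] delete_first_commute[OF assms] by metis
qed

definition acts :: "('v \<times> 'a) list \<Rightarrow> ('v \<times> 'a) list \<Rightarrow> ('v \<times> 'a) list"
  where "acts u w = foldr act u w"

lemma acts_simps [simp]:
  "acts [] w = w" "acts (x # u) w = act x (acts u w)" "acts (u @ v) w = acts u (acts v w)"
  by (simp_all add: acts_def)

lemma acts_cong: "shuffle_eq E v w \<Longrightarrow> shuffle_eq E (acts u v) (acts u w)"
  by (induction u) (simp_all add: act_cong)

lemma all_words_simps [simp]:
  "[] \<in> all_words V G"
  "x # u \<in> all_words V G \<longleftrightarrow> fst x \<in> V \<and> snd x \<in> carrier (G (fst x)) \<and> u \<in> all_words V G"
  "u @ v \<in> all_words V G \<longleftrightarrow> u \<in> all_words V G \<and> v \<in> all_words V G"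
  by (cases x; auto simp: all_words_def)+

lemma reduced_acts: "u \<in> all_words V G \<Longrightarrow> reduced w \<Longrightarrow> reduced (acts u w)"
  by (induction u) (simp_all add: reduced_act)

text \<open>A reduced word can thus be read off from its action on the empty word, which is what
  turns the action into uniqueness of normal forms.\<close>

lemma acts_reduced: "reduced u \<Longrightarrow> acts u [] = u"
proof (induction u)
  case (Cons x u)
  then interpret group "G (fst x)" by (simp add: group_at)
  show ?case
    using Cons by (auto simp: act_def cons_def head_def delete_first_None)
qed simp

section \<open>The free product as a group of classes of words\<close>

abbreviation F :: "('v \<times> 'a) list set monoid" where "F \<equiv> free_product V G"

abbreviation cls :: "('v \<times> 'a) list \<Rightarrow> ('v \<times> 'a) list set" where "cls u \<equiv> free_rel V G `` {u}"

lemma equiv_free_rel: "equiv (all_words V G) (free_rel V G)"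
  by (intro equivI refl_onI symI transI)
    (auto simp: free_rel_def intro: equivclp_sym equivp_transp[OF equivp_evquivclp] equivp_reflp[OF equivp_evquivclp])

lemma cls_eq_iff:
  "u \<in> all_words V G \<Longrightarrow> v \<in> all_words V G \<Longrightarrow> cls u = cls v \<longleftrightarrow> (u, v) \<in> free_rel V G"
  using eq_equiv_class_iff[OF equiv_free_rel] .

lemma free_step_append: "free_step V G u v \<Longrightarrow> free_step V G (a @ u @ b) (a @ v @ b)"
proof (induction rule: free_step.induct)
  case (mult I g h us vs)
  then show ?case using free_step.mult[of I V g G h "a @ us" "vs @ b"] by simp
next
  case (one I us vs)
  then show ?case using free_step.one[of I V G "a @ us" "vs @ b"] by simp
qed

lemma free_rel_step:
  "free_step V G u v \<Longrightarrow> u \<in> all_words V G \<Longrightarrow> v \<in> all_words V G \<Longrightarrow> (u, v) \<in> free_rel V G"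
  by (auto simp: free_rel_def equivclp_def intro: symclpI)

lemma equivclp_free_step_append:
  "equivclp (free_step V G) u v \<Longrightarrow> equivclp (free_step V G) (a @ u @ b) (a @ v @ b)"
proof (induction rule: equivclp_induct)
  case (step y z)
  then have "symclp (free_step V G) (a @ y @ b) (a @ z @ b)"
    by (auto intro: free_step_append symclpI)
  then show ?case
    using step.IH unfolding equivclp_def by (rule rtranclp.rtrancl_into_rtrancl[rotated])
qed (simp add: equivclp_def)

lemma free_rel_append:
  assumes "(u, u') \<in> free_rel V G" "(v, v') \<in> free_rel V G"
  shows "(u @ v, u' @ v') \<in> free_rel V G"
proof -
  have "equivclp (free_step V G) (u @ v) (u' @ v)"
    using assms equivclp_free_step_append[of u u' "[]" v] by (simp add: free_rel_def)
  moreover have "equivclp (free_step V G) (u' @ v) (u' @ v')"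
    using assms equivclp_free_step_append[of v v' u' "[]"] by (simp add: free_rel_def)
  ultimately show ?thesis
    using assms by (auto simp: free_rel_def intro: equivp_transp[OF equivp_evquivclp])
qed

lemma carrier_free_product: "carrier F = cls ` all_words V G"
  by (auto simp: free_product_def quotient_def)

lemma one_free_product: "\<one>\<^bsub>F\<^esub> = cls []"
  by (simp add: free_product_def)

lemma mult_free_product:
  assumes "u \<in> all_words V G" "v \<in> all_words V G"
  shows "cls u \<otimes>\<^bsub>F\<^esub> cls v = cls (u @ v)"
proof -
  \<comment> \<open>The union defining the product ranges over representatives; all of them give the
    same class.\<close>
  have "cls (u' @ v') = cls (u @ v)" if "u' \<in> cls u" "v' \<in> cls v" for u' v'
  proof -
    have "(u @ v, u' @ v') \<in> free_rel V G"
      using that by (intro free_rel_append) auto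
    then show ?thesis
      by (metis equiv_class_eq equiv_free_rel)
  qed
  moreover have "u \<in> cls u" "v \<in> cls v"
    using assms equiv_class_self[OF equiv_free_rel] by auto
  ultimately show ?thesis
    unfolding free_product_def monoid.simps by blast
qed

lemma cls_mult_letters:
  assumes "I \<in> V" "g \<in> carrier (G I)" "h \<in> carrier (G I)" "u \<in> all_words V G" "v \<in> all_words V G"
  shows "cls (u @ [(I, g), (I, h)] @ v) = cls (u @ [(I, g \<otimes>\<^bsub>G I\<^esub> h)] @ v)"
  using assms group_at[of I]
  by (subst cls_eq_iff) (auto intro!: free_rel_step free_step.mult simp: group.is_monoid monoid.m_closed
    simp del: append_Cons append_Nil)

lemma cls_one_letter:
  assumes "I \<in> V" "u \<in> all_words V G" "v \<in> all_words V G"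
  shows "cls (u @ [(I, \<one>\<^bsub>G I\<^esub>)] @ v) = cls (u @ v)"
  using assms group_at[of I]
  by (subst cls_eq_iff) (auto intro!: free_rel_step free_step.one simp: group.is_monoid
    simp del: append_Cons append_Nil)

lemma free_product_left_inverse:
  "u \<in> all_words V G \<Longrightarrow> \<exists>v\<in>all_words V G. cls (v @ u) = cls []"
proof (induction u)
  case (Cons x u)
  obtain I g where x: "x = (I, g)" by fastforce
  then interpret group "G I" using Cons.prems by (simp add: group_at)
  obtain v where v: "v \<in> all_words V G" "cls (v @ u) = cls []"
    using Cons by auto
  have "cls ((v @ [(I, inv\<^bsub>G I\<^esub> g)]) @ x # u) = cls (v @ [(I, \<one>\<^bsub>G I\<^esub>)] @ u)"
    using Cons.prems cls_mult_letters[of I "inv\<^bsub>G I\<^esub> g" g v u] v x by simp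
  also have "\<dots> = cls []"
    using Cons.prems cls_one_letter[of I v u] v x by simp
  finally show ?case
    using v Cons.prems x by (intro bexI[of _ "v @ [(I, inv\<^bsub>G I\<^esub> g)]"]) auto
qed (auto intro: bexI[of _ "[]"])

lemma group_free_product: "group F"
proof (rule groupI)
  fix x assume "x \<in> carrier F"
  then show "\<exists>y\<in>carrier F. y \<otimes>\<^bsub>F\<^esub> x = \<one>\<^bsub>F\<^esub>"
    using free_product_left_inverse
    by (fastforce simp: carrier_free_product one_free_product mult_free_product)
qed (auto simp: carrier_free_product one_free_product mult_free_product)

sublocale F: group F
  by (rule group_free_product)

lemma inv_cls_letter:
  assumes "I \<in> V" "g \<in> carrier (G I)"
  shows "inv\<^bsub>F\<^esub> cls [(I, g)] = cls [(I, inv\<^bsub>G I\<^esub> g)]"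
proof -
  interpret group "G I" using assms by (simp add: group_at)
  have "cls [(I, inv\<^bsub>G I\<^esub> g)] \<otimes>\<^bsub>F\<^esub> cls [(I, g)] = \<one>\<^bsub>F\<^esub>"
    using assms cls_mult_letters[of I "inv\<^bsub>G I\<^esub> g" g "[]" "[]"] cls_one_letter[of I "[]" "[]"]
    by (simp add: mult_free_product one_free_product)
  then show ?thesis
    using assms by (intro F.inv_equality) (auto simp: carrier_free_product)
qed

section \<open>The action of the free product and the elements acting trivially\<close>

lemma acts_free_step:
  assumes "free_step V G u v" "u \<in> all_words V G" "reduced w"
  shows "shuffle_eq E (acts u w) (acts v w)"
  using assms
proof (induction rule: free_step.induct)
  case (mult I g h us vs)
  then show ?case by (simp add: act_mult reduced_acts)
next
  case (one I us vs)
  then show ?case by (auto intro!: acts_cong act_one reduced_acts)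
qed

lemma free_step_all_words: "free_step V G u v \<Longrightarrow> u \<in> all_words V G \<longleftrightarrow> v \<in> all_words V G"
  by (induction rule: free_step.induct) (auto simp: group_at group.is_monoid monoid.m_closed)

lemma acts_free_rel:
  assumes "(u, v) \<in> free_rel V G" "reduced w"
  shows "shuffle_eq E (acts u w) (acts v w)"
proof -
  have "equivclp (free_step V G) u v" "u \<in> all_words V G"
    using assms by (auto simp: free_rel_def)
  \<comment> \<open>Membership in \<open>all_words\<close> is carried along for the intermediate
    words of the chain, as \<open>acts_free_step\<close> requires it at every step.\<close>
  then have "v \<in> all_words V G \<and> shuffle_eq E (acts u w) (acts v w)"
  proof (induction rule: equivclp_induct)
    case (step y z)
    then have "z \<in> all_words V G" "shuffle_eq E (acts y w) (acts z w)"
      using acts_free_step[of y z w] acts_free_step[of z y w] free_step_all_words[of y z]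
        free_step_all_words[of z y] assms(2) by (auto intro: shuffle_eq_sym)
    then show ?case using step by (blast intro: shuffle_eq_trans)
  qed simp
  then show ?thesis ..
qed

text \<open>A normal subgroup containing the edge commutators, hence the whole graph kernel.\<close>
definition trivially_acting :: "('v \<times> 'a) list set set"
  where "trivially_acting = {A \<in> carrier F. \<forall>u\<in>A. \<forall>w. reduced w \<longrightarrow> shuffle_eq E (acts u w) w}"

text \<open>One representative decides, since related words act alike by
  \<open>acts_free_rel\<close>.\<close>

lemma cls_trivially_acting_iff:
  assumes "u \<in> all_words V G"
  shows "cls u \<in> trivially_acting \<longleftrightarrow> (\<forall>w. reduced w \<longrightarrow> shuffle_eq E (acts u w) w)"
proof -
  have "u \<in> cls u" using assms equiv_class_self[OF equiv_free_rel] by auto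
  then show ?thesis
    using assms unfolding trivially_acting_def carrier_free_product
    by auto (meson acts_free_rel shuffle_eq_trans shuffle_eq_sym)
qed

lemma subgroup_trivially_acting: "subgroup trivially_acting F"
proof (rule F.subgroupI)
  show "trivially_acting \<noteq> {}"
    using cls_trivially_acting_iff[of "[]"] by auto
next
  fix A assume A: "A \<in> trivially_acting"
  then obtain u where u: "A = cls u" "u \<in> all_words V G"
    by (auto simp: trivially_acting_def carrier_free_product)
  obtain v where v: "inv\<^bsub>F\<^esub> A = cls v" "v \<in> all_words V G"
    using F.inv_closed[of A] A by (auto simp: trivially_acting_def carrier_free_product)
  have "shuffle_eq E (acts v w) w" if "reduced w" for w
  proof -
    \<comment> \<open>\<open>acts u (acts v w)\<close> is equivalent to \<open>w\<close> because
      \<open>u @ v\<close> represents the identity, and to \<open>acts v w\<close> because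
      \<open>u\<close> acts trivially.\<close>
    have "cls (u @ v) = cls []"
      using u v F.r_inv[of A] by (auto simp: carrier_free_product mult_free_product one_free_product)
    then have "shuffle_eq E (acts u (acts v w)) w"
      using acts_free_rel[of "u @ v" "[]" w] that u v by (simp add: cls_eq_iff)
    moreover have "shuffle_eq E (acts u (acts v w)) (acts v w)"
      using A u v that by (simp add: cls_trivially_acting_iff reduced_acts)
    ultimately show ?thesis by (blast intro: shuffle_eq_trans shuffle_eq_sym)
  qed
  then show "inv\<^bsub>F\<^esub> A \<in> trivially_acting" using v by (simp add: cls_trivially_acting_iff)
next
  fix A B assume "A \<in> trivially_acting" "B \<in> trivially_acting"
  moreover from this obtain u v where "A = cls u" "u \<in> all_words V G" "B = cls v" "v \<in> all_words V G"
    by (auto simp: trivially_acting_def carrier_free_product)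
  ultimately show "A \<otimes>\<^bsub>F\<^esub> B \<in> trivially_acting"
    by (auto simp: mult_free_product cls_trivially_acting_iff)
      (meson reduced_acts shuffle_eq_trans)
qed (auto simp: trivially_acting_def)

lemma normal_trivially_acting: "trivially_acting \<lhd> F"
  unfolding F.normal_inv_iff
proof (intro conjI ballI subgroup_trivially_acting)
  fix A B assume A: "A \<in> carrier F" and B: "B \<in> trivially_acting"
  obtain u where u: "A = cls u" "u \<in> all_words V G"
    using A by (auto simp: carrier_free_product)
  obtain u' where u': "inv\<^bsub>F\<^esub> A = cls u'" "u' \<in> all_words V G"
    using F.inv_closed[OF A] by (auto simp: carrier_free_product)
  obtain v where v: "B = cls v" "v \<in> all_words V G"
    using B by (auto simp: trivially_acting_def carrier_free_product)
  have "shuffle_eq E (acts u (acts v (acts u' w))) w" if "reduced w" for w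
  proof -
    have "shuffle_eq E (acts u (acts v (acts u' w))) (acts u (acts u' w))"
      using B v u' that by (intro acts_cong) (simp add: cls_trivially_acting_iff reduced_acts)
    moreover have "cls (u @ u') = cls []"
      using u u' F.r_inv[of A] by (auto simp: carrier_free_product mult_free_product one_free_product)
    then have "shuffle_eq E (acts u (acts u' w)) w"
      using acts_free_rel[of "u @ u'" "[]" w] that u u' by (simp add: cls_eq_iff)
    ultimately show ?thesis by (rule shuffle_eq_trans)
  qed
  then show "A \<otimes>\<^bsub>F\<^esub> B \<otimes>\<^bsub>F\<^esub> inv\<^bsub>F\<^esub> A \<in> trivially_acting"
    using u u' v by (simp add: mult_free_product cls_trivially_acting_iff)
qed

lemma edge_commutator_eq:
  assumes "I \<in> V" "J \<in> V" "g \<in> carrier (G I)" "h \<in> carrier (G J)"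
  shows "cls [(I, g)] \<otimes>\<^bsub>F\<^esub> cls [(J, h)] \<otimes>\<^bsub>F\<^esub> inv\<^bsub>F\<^esub> cls [(I, g)] \<otimes>\<^bsub>F\<^esub> inv\<^bsub>F\<^esub> cls [(J, h)]
    = cls [(I, g), (J, h), (I, inv\<^bsub>G I\<^esub> g), (J, inv\<^bsub>G J\<^esub> h)]"
  using assms group_at by (simp add: inv_cls_letter mult_free_product group.inv_closed)

lemma edge_commutators_trivially_acting: "edge_commutators V E G \<subseteq> trivially_acting"
proof
  fix A assume "A \<in> edge_commutators V E G"
  then obtain I J g h where A: "A = cls [(I, g), (J, h), (I, inv\<^bsub>G I\<^esub> g), (J, inv\<^bsub>G J\<^esub> h)]"
    and IJ: "I \<in> V" "J \<in> V" "adjacent E I J" "g \<in> carrier (G I)" "h \<in> carrier (G J)"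
    unfolding edge_commutators_def free_incl_def Let_def using edge_commutator_eq by auto
  interpret I: group "G I" using IJ by (simp add: group_at)
  interpret J: group "G J" using IJ by (simp add: group_at)
  have "shuffle_eq E (act (I, g) (act (J, h) (act (I, inv\<^bsub>G I\<^esub> g) (act (J, inv\<^bsub>G J\<^esub> h) w)))) w"
    if "reduced w" for w
  proof -
    have red: "reduced (act (J, inv\<^bsub>G J\<^esub> h) w)" "reduced (act (J, h) (act (J, inv\<^bsub>G J\<^esub> h) w))"
      using IJ that by (simp_all add: reduced_act)
    \<comment> \<open>Swapping the two middle letters brings each letter next to its inverse, and
      both pairs collapse.\<close>
    have "shuffle_eq E (act (I, g) (act (J, h) (act (I, inv\<^bsub>G I\<^esub> g) (act (J, inv\<^bsub>G J\<^esub> h) w))))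
      (act (I, g) (act (I, inv\<^bsub>G I\<^esub> g) (act (J, h) (act (J, inv\<^bsub>G J\<^esub> h) w))))"
      using IJ by (intro act_cong act_commute) (simp add: adjacent_sym)
    also have "\<dots> = act (I, \<one>\<^bsub>G I\<^esub>) (act (J, h) (act (J, inv\<^bsub>G J\<^esub> h) w))"
      using IJ red by (simp add: act_mult)
    also have "shuffle_eq E \<dots> (act (J, h) (act (J, inv\<^bsub>G J\<^esub> h) w))"
      using IJ red by (intro act_one)
    also have "\<dots> = act (J, \<one>\<^bsub>G J\<^esub>) w"
      using IJ that by (simp add: act_mult)
    also have "shuffle_eq E \<dots> w"
      using IJ that by (intro act_one)
    finally show ?thesis .
  qed
  then show "A \<in> trivially_acting"
    using IJ unfolding A by (subst cls_trivially_acting_iff) auto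
qed

section \<open>The graph kernel and uniqueness of normal forms\<close>

abbreviation N :: "('v \<times> 'a) list set set" where "N \<equiv> graph_kernel V E G"

lemma normal_graph_kernel: "N \<lhd> F"
proof -
  let ?M = "{M. M \<lhd> F \<and> edge_commutators V E G \<subseteq> M}"
  \<comment> \<open>An intersection of subgroups needs a nonempty family;
    \<open>trivially_acting\<close> is the member that provides this.\<close>
  have "subgroup (\<Inter>?M) F"
    using normal_trivially_acting edge_commutators_trivially_acting
    by (intro F.subgroups_Inter) (auto dest: normal_imp_subgroup)
  then show ?thesis
    unfolding graph_kernel_def normal_closure_def F.normal_inv_iff
    by (auto simp: F.normal_inv_iff)
qed

sublocale N: normal N F
  by (rule normal_graph_kernel)

lemma graph_kernel_subset_trivially_acting: "N \<subseteq> trivially_acting"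
  using normal_trivially_acting edge_commutators_trivially_acting
  unfolding graph_kernel_def normal_closure_def by auto

lemma edge_commutators_subset_graph_kernel: "edge_commutators V E G \<subseteq> N"
  unfolding graph_kernel_def normal_closure_def by auto

abbreviation GP :: "('v \<times> 'a) list set set monoid" where "GP \<equiv> graph_product V E G"

abbreviation val :: "('v \<times> 'a) list \<Rightarrow> ('v \<times> 'a) list set set" where "val \<equiv> word_value V E G"

sublocale GP: group GP
  unfolding graph_product_def by (rule N.factorgroup_is_group)

lemma word_value_eq_coset: "u \<in> all_words V G \<Longrightarrow> val u = N #>\<^bsub>F\<^esub> cls u"
proof (induction u)
  case Nil
  show ?case
    by (simp add: word_value_def graph_product_def one_free_product[symmetric] F.coset_mult_one N.subset)
next
  case (Cons x u)
  have "val (x # u) = (N #>\<^bsub>F\<^esub> cls [x]) <#>\<^bsub>F\<^esub> val u"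
    by (simp add: word_value_def graph_product_def vertex_incl_def free_incl_def split: prod.split)
  also have "\<dots> = N #>\<^bsub>F\<^esub> (cls [x] \<otimes>\<^bsub>F\<^esub> cls u)"
    using Cons by (simp add: N.rcos_sum carrier_free_product)
  finally show ?case using Cons.prems by (simp add: mult_free_product)
qed

lemma carrier_graph_product: "carrier GP = val ` all_words V G"
  by (force simp: graph_product_def carrier_FactGroup carrier_free_product word_value_eq_coset image_image)

lemma word_value_closed [simp]: "u \<in> all_words V G \<Longrightarrow> val u \<in> carrier GP"
  by (simp add: carrier_graph_product)

lemma word_value_Nil [simp]: "val [] = \<one>\<^bsub>GP\<^esub>"
  by (simp add: word_value_def)

lemma word_value_append:
  "u \<in> all_words V G \<Longrightarrow> v \<in> all_words V G \<Longrightarrow> val (u @ v) = val u \<otimes>\<^bsub>GP\<^esub> val v"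
  by (simp add: word_value_eq_coset graph_product_def N.rcos_sum carrier_free_product mult_free_product)

text \<open>The action descends to the graph product: words of equal value differ in the free
  product by a factor from the kernel, and the kernel acts trivially.\<close>

lemma acts_word_value_eq:
  assumes "u \<in> all_words V G" "v \<in> all_words V G" "val u = val v" "reduced w"
  shows "shuffle_eq E (acts u w) (acts v w)"
proof -
  have "cls u \<in> N #>\<^bsub>F\<^esub> cls v"
    using assms F.rcos_self[of "cls u" N] N.subgroup_axioms
    by (simp add: word_value_eq_coset carrier_free_product)
  then obtain A where A: "A \<in> N" "cls u = A \<otimes>\<^bsub>F\<^esub> cls v"
    by (auto simp: r_coset_def)
  then obtain m where m: "A = cls m" "m \<in> all_words V G"
    using N.subset by (auto simp: carrier_free_product)
  have "shuffle_eq E (acts u w) (acts (m @ v) w)"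
    using A m assms by (intro acts_free_rel) (simp_all add: mult_free_product cls_eq_iff[symmetric])
  also have "shuffle_eq E (acts (m @ v) w) (acts v w)"
    using A m assms graph_kernel_subset_trivially_acting cls_trivially_acting_iff[of m]
    by (auto simp: reduced_acts)
  finally show ?thesis .
qed

text \<open>Both words act alike on the empty word, where \<open>acts_reduced\<close> returns the
  words themselves.\<close>

theorem normal_form_unique:
  assumes "reduced u" "reduced v" "val u = val v"
  shows "shuffle_eq E u v"
  using acts_word_value_eq[of u v "[]"] assms reduced_generator_words generator_words_subset
  by (auto simp: acts_reduced)

section \<open>Vertex inclusions and values of words\<close>

abbreviation \<iota> :: "'v \<Rightarrow> 'a \<Rightarrow> ('v \<times> 'a) list set set" where "\<iota> \<equiv> vertex_incl V E G"

lemma word_value_Cons: "val (x # u) = \<iota> (fst x) (snd x) \<otimes>\<^bsub>GP\<^esub> val u"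
  by (simp add: word_value_def split: prod.split)

lemma vertex_incl_eq_word_value: "I \<in> V \<Longrightarrow> g \<in> carrier (G I) \<Longrightarrow> \<iota> I g = val [(I, g)]"
  by (simp add: word_value_eq_coset vertex_incl_def free_incl_def)

lemma vertex_incl_closed [simp]: "I \<in> V \<Longrightarrow> g \<in> carrier (G I) \<Longrightarrow> \<iota> I g \<in> carrier GP"
  by (simp add: vertex_incl_eq_word_value)

lemma vertex_incl_mult:
  assumes "I \<in> V" "g \<in> carrier (G I)" "h \<in> carrier (G I)"
  shows "\<iota> I (g \<otimes>\<^bsub>G I\<^esub> h) = \<iota> I g \<otimes>\<^bsub>GP\<^esub> \<iota> I h"
proof -
  have "val [(I, g), (I, h)] = val [(I, g \<otimes>\<^bsub>G I\<^esub> h)]"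
    using assms cls_mult_letters[of I g h "[]" "[]"] group_at[of I]
    by (simp add: word_value_eq_coset group.is_monoid monoid.m_closed)
  then show ?thesis
    using assms group_at[of I] word_value_append[of "[(I, g)]" "[(I, h)]"]
    by (simp add: vertex_incl_eq_word_value group.is_monoid monoid.m_closed)
qed

lemma vertex_incl_one [simp]:
  assumes "I \<in> V"
  shows "\<iota> I \<one>\<^bsub>G I\<^esub> = \<one>\<^bsub>GP\<^esub>"
  using assms cls_one_letter[of I "[]" "[]"] group_at[of I] word_value_eq_coset[of "[]"]
  by (simp add: vertex_incl_eq_word_value group.is_monoid word_value_eq_coset)

lemma vertex_incl_commute:
  assumes "I \<in> V" "J \<in> V" "adjacent E I J" "g \<in> carrier (G I)" "h \<in> carrier (G J)"
  shows "\<iota> I g \<otimes>\<^bsub>GP\<^esub> \<iota> J h = \<iota> J h \<otimes>\<^bsub>GP\<^esub> \<iota> I g"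
proof -
  let ?a = "cls [(I, g)]" and ?b = "cls [(J, h)]"
  have ab: "?a \<in> carrier F" "?b \<in> carrier F"
    using assms by (simp_all add: carrier_free_product)
  have "?a \<otimes>\<^bsub>F\<^esub> ?b \<otimes>\<^bsub>F\<^esub> inv\<^bsub>F\<^esub> ?a \<otimes>\<^bsub>F\<^esub> inv\<^bsub>F\<^esub> ?b \<in> N"
    using assms edge_commutators_subset_graph_kernel
    unfolding edge_commutators_def free_incl_def Let_def by blast
  \<comment> \<open>Written as a quotient of the two products, the commutator lying in the kernel
    says that their cosets coincide.\<close>
  moreover have "?a \<otimes>\<^bsub>F\<^esub> ?b \<otimes>\<^bsub>F\<^esub> inv\<^bsub>F\<^esub> ?a \<otimes>\<^bsub>F\<^esub> inv\<^bsub>F\<^esub> ?b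
      = (?a \<otimes>\<^bsub>F\<^esub> ?b) \<otimes>\<^bsub>F\<^esub> inv\<^bsub>F\<^esub> (?b \<otimes>\<^bsub>F\<^esub> ?a)"
    using ab by (simp add: F.inv_mult_group F.m_assoc)
  ultimately have "N #>\<^bsub>F\<^esub> (?a \<otimes>\<^bsub>F\<^esub> ?b) = N #>\<^bsub>F\<^esub> (?b \<otimes>\<^bsub>F\<^esub> ?a)"
    using ab by (metis F.coset_join2 F.coset_mult_assoc F.coset_mult_inv1 F.inv_closed F.m_closed N.subgroup_axioms N.subset)
  then show ?thesis
    using assms ab by (simp add: vertex_incl_eq_word_value word_value_eq_coset graph_product_def N.rcos_sum)
qed

lemma all_words_subset: "set u \<subseteq> set w \<Longrightarrow> w \<in> all_words V G \<Longrightarrow> u \<in> all_words V G"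
  by (auto simp: all_words_def)

lemma word_value_first_letter:
  "w \<in> all_words V G \<Longrightarrow> first_letter E I w = Some g \<Longrightarrow>
    val w = \<iota> I g \<otimes>\<^bsub>GP\<^esub> val (delete_first E I w)"
proof (induction w)
  case (Cons x w)
  show ?case
  proof (cases "fst x = I")
    case True
    then show ?thesis using Cons.prems by (cases x) (auto simp: word_value_Cons)
  next
    case False
    then have adj: "adjacent E I (fst x)" "first_letter E I w = Some g"
      using Cons.prems by (auto split: if_splits)
    then have "(I, g) \<in> set w" by (simp add: first_letter_mem)
    then have Ig: "I \<in> V" "g \<in> carrier (G I)"
      using Cons.prems by (auto simp: all_words_def)
    have x: "\<iota> (fst x) (snd x) \<in> carrier GP" and d: "val (delete_first E I w) \<in> carrier GP"
      using Cons.prems all_words_subset[OF set_delete_first_subset, of w] by simp_all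
    have "\<iota> (fst x) (snd x) \<otimes>\<^bsub>GP\<^esub> \<iota> I g = \<iota> I g \<otimes>\<^bsub>GP\<^esub> \<iota> (fst x) (snd x)"
      using adj Ig Cons.prems by (intro vertex_incl_commute) (simp_all add: adjacent_sym)
    then show ?thesis
      using Cons adj False Ig x d
      by (simp add: word_value_Cons GP.m_assoc[symmetric])
  qed
qed simp

text \<open>The leading letter of \<open>u\<close> is an initial letter of \<open>w\<close>, so
  \<open>word_value_first_letter\<close> pulls it out of \<open>w\<close> and the induction
  continues with what remains.\<close>

lemma word_value_cong:
  "u \<in> all_words V G \<Longrightarrow> shuffle_eq E u w \<Longrightarrow> val u = val w"
proof (induction u arbitrary: w)
  case (Cons x u)
  have f: "first_letter E (fst x) w = Some (snd x)"
    using first_letter_cong[OF Cons.prems(2), of "fst x"] by simp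
  have "shuffle_eq E u (delete_first E (fst x) w)"
    using delete_first_cong[OF Cons.prems(2), of "fst x"] by simp
  moreover have "w \<in> all_words V G"
    using Cons.prems(1) shuffle_eq_set[OF Cons.prems(2)] by (metis all_words_subset order_refl)
  ultimately show ?case
    using Cons f by (simp add: word_value_first_letter word_value_Cons)
qed simp

lemma reduced_all_words: "reduced w \<Longrightarrow> w \<in> all_words V G"
  using reduced_generator_words generator_words_subset by blast

lemma word_value_cons:
  "reduced w \<Longrightarrow> I \<in> V \<Longrightarrow> val (cons I g w) = \<iota> I g \<otimes>\<^bsub>GP\<^esub> val w"
  by (simp add: cons_def word_value_Cons reduced_all_words)

text \<open>The action models left multiplication. Hence any word, acting on the empty word, yields
  a reduced word of the same value; this is how \<open>ex_reduced_word\<close> obtains normal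
  forms.\<close>

lemma word_value_act:
  assumes "reduced w" "fst x \<in> V" "snd x \<in> carrier (G (fst x))"
  shows "val (act x w) = \<iota> (fst x) (snd x) \<otimes>\<^bsub>GP\<^esub> val w"
proof -
  let ?I = "fst x" and ?d = "delete_first E (fst x) w"
  have d: "reduced ?d" using assms by (simp add: reduced_delete_first)
  have "val w = \<iota> ?I (head ?I w) \<otimes>\<^bsub>GP\<^esub> val ?d"
    using word_value_cong[OF reduced_all_words cons_head, of w ?I] assms d by (simp add: word_value_cons)
  then show ?thesis
    using assms d by (simp add: act_def word_value_cons vertex_incl_mult GP.m_assoc reduced_all_words)
qed

lemma word_value_acts:
  "u \<in> all_words V G \<Longrightarrow> reduced w \<Longrightarrow> val (acts u w) = val u \<otimes>\<^bsub>GP\<^esub> val w"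
  by (induction u) (simp_all add: word_value_act reduced_acts word_value_Cons GP.m_assoc reduced_all_words)

lemma ex_reduced_word:
  assumes "x \<in> carrier GP"
  shows "\<exists>w. reduced w \<and> val w = x"
proof -
  obtain u where "u \<in> all_words V G" "x = val u"
    using assms by (auto simp: carrier_graph_product)
  then show ?thesis
    using reduced_acts[of u "[]"] word_value_acts[of u "[]"] by auto
qed

section \<open>Reduced expressions and the local criterion\<close>

lemma reduced_append: "reduced (u @ v) \<Longrightarrow> reduced v"
  by (induction u) simp_all

text \<open>If the tail is reduced, the leading letter clashes with an initial letter of the tail at
  its own vertex. Shuffling moves the two together, and amalgamating or cancelling them saves at
  least one letter.\<close>

lemma not_reduced_shorten:
  "w \<in> generator_words V G \<Longrightarrow> \<not> reduced w \<Longrightarrow>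
    \<exists>w'. (word_step E G)\<^sup>*\<^sup>* w w' \<and> length w' < length w"
proof (induction w)
  case (Cons x w)
  obtain I g where x: "x = (I, g)" by fastforce
  have w: "w \<in> generator_words V G" using Cons.prems by (simp add: generator_words_def)
  show ?case
  proof (cases "reduced w")
    case False
    then obtain w' where "(word_step E G)\<^sup>*\<^sup>* w w'" "length w' < length w"
      using Cons w by blast
    then show ?thesis
      using word_steps_append[of E G w w' "[x]" "[]"] by (auto intro!: exI[of _ "x # w'"])
  next
    case True
    then have "first_letter E I w \<noteq> None"
      using Cons.prems x by (auto simp: generator_words_def)
    then obtain h u v where h: "w = u @ (I, h) # v" "\<forall>x\<in>set u. adjacent E I (fst x)"
      using first_letter_split[of E I w] by fastforce
    have "(word_step E G)\<^sup>*\<^sup>* (x # w) (u @ [(I, g), (I, h)] @ v)"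
      using h x word_steps_move[of u E "(I, g)" G "(I, h) # v"] by simp
    moreover have "\<exists>w'. word_step E G (u @ [(I, g), (I, h)] @ v) w' \<and> length w' < length (x # w)"
    proof (cases "g \<otimes>\<^bsub>G I\<^esub> h = \<one>\<^bsub>G I\<^esub>")
      case True
      show ?thesis by (intro exI conjI, rule word_step.cancel, rule True) (simp add: h)
    next
      case False
      show ?thesis by (intro exI conjI, rule word_step.amalgamate, rule False) (simp add: h)
    qed
    ultimately show ?thesis by (meson rtranclp.rtrancl_into_rtrancl)
  qed
qed simp

text \<open>Two neighbouring letters at one vertex contradict \<open>reduced\<close>, so a shuffle
  is the only possible step.\<close>

lemma word_step_reduced:
  assumes "word_step E G u w" "reduced u"
  shows "reduced w \<and> shuffle_eq E u w"
  using assms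
proof (induction rule: word_step.induct)
  case (shuffle I J us g h vs)
  then have "shuffle_eq E (us @ [(I, g), (J, h)] @ vs) (us @ [(J, h), (I, g)] @ vs)"
    by (simp add: shuffle_eq_swap)
  then show ?case using shuffle.prems reduced_cong by blast
qed (use reduced_append in fastforce)+

lemma reduced_expression_iff:
  "reduced_expression V E G x w \<longleftrightarrow> reduced w \<and> val w = x"
proof
  assume "reduced_expression V E G x w"
  then show "reduced w \<and> val w = x"
    using not_reduced_shorten[of w] by (force simp: reduced_expression_def expression_def)
next
  assume w: "reduced w \<and> val w = x"
  have "reduced w' \<and> shuffle_eq E w w'" if "(word_step E G)\<^sup>*\<^sup>* w w'" for w'
    using that by (induction rule: rtranclp_induct)
      (use w word_step_reduced in \<open>auto intro: shuffle_eq_trans\<close>)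
  then have "length w \<le> length w'" if "(word_step E G)\<^sup>*\<^sup>* w w'" for w'
    using that shuffle_eq_length by fastforce
  then show "reduced_expression V E G x w"
    using w by (simp add: reduced_expression_def expression_def reduced_generator_words)
qed

section \<open>Normal forms, initial and remaining parts, and supports\<close>

definition nf :: "('v \<times> 'a) list set set \<Rightarrow> ('v \<times> 'a) list"
  where "nf x = (SOME w. reduced w \<and> val w = x)"

lemma nf: "x \<in> carrier GP \<Longrightarrow> reduced (nf x)" "x \<in> carrier GP \<Longrightarrow> val (nf x) = x"
  using someI_ex[OF ex_reduced_word, of x] by (simp_all add: nf_def)

lemma nf_word_value: "reduced w \<Longrightarrow> shuffle_eq E (nf (val w)) w"
  by (rule normal_form_unique) (simp_all add: nf reduced_all_words)

definition init :: "'v \<Rightarrow> ('v \<times> 'a) list set set \<Rightarrow> 'a"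
  where "init I x = head I (nf x)"

definition rest :: "'v \<Rightarrow> ('v \<times> 'a) list set set \<Rightarrow> ('v \<times> 'a) list set set"
  where "rest I x = val (delete_first E I (nf x))"

abbreviation supp :: "('v \<times> 'a) list set set \<Rightarrow> 'v set" where "supp \<equiv> vertices_on V E G"

text \<open>\<open>nf\<close> is an arbitrary choice, unique only up to shuffling. This lemma and
  the next two free \<open>init\<close>, \<open>rest\<close> and \<open>supp\<close> from that
  choice.\<close>

lemma init_word_value: "reduced w \<Longrightarrow> init I (val w) = head I w"
  by (simp add: init_def nf_word_value head_cong)

lemma rest_word_value: "reduced w \<Longrightarrow> rest I (val w) = val (delete_first E I w)"
  unfolding rest_def
  by (intro word_value_cong delete_first_cong nf_word_value reduced_all_words reduced_delete_first nf)
    (simp_all add: reduced_all_words)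

lemma supp_word_value: "reduced w \<Longrightarrow> supp (val w) = fst ` set w"
  unfolding vertices_on_def reduced_expression_iff
  using normal_form_unique shuffle_eq_set by blast

text \<open>The right-hand side admits at most one \<open>g\<close>, which justifies the definite
  description in \<open>initial_part\<close>.\<close>

lemma initial_letter_iff:
  assumes "x \<in> carrier GP"
  shows "initial_letter V E G I x g \<longleftrightarrow> first_letter E I (nf x) = Some g"
proof
  assume "initial_letter V E G I x g"
  then obtain w i where w: "reduced w" "val w = x" "i < length w" "w ! i = (I, g)"
      "\<forall>j<i. adjacent E I (fst (w ! j))"
    by (auto simp: initial_letter_def reduced_expression_iff)
  then have "w = take i w @ (I, g) # drop (Suc i) w"
    by (metis id_take_nth_drop)
  moreover have "\<forall>y\<in>set (take i w). adjacent E I (fst y)"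
    using w by (auto simp: in_set_conv_nth simp del: split_paired_All) (metis fst_conv)
  ultimately have "first_letter E I w = Some g"
    using first_letter_append_adjacent[of "take i w" E I "(I, g) # drop (Suc i) w"] by simp
  then show "first_letter E I (nf x) = Some g"
    using first_letter_cong[OF nf_word_value[OF w(1)], of I] w by simp
next
  assume "first_letter E I (nf x) = Some g"
  then obtain u v where "nf x = u @ (I, g) # v" "\<forall>x\<in>set u. adjacent E I (fst x)"
    using first_letter_split by metis
  then show "initial_letter V E G I x g"
    unfolding initial_letter_def reduced_expression_iff using nf[OF assms]
    by (intro exI[of _ "nf x"] exI[of _ "length u"]) (auto simp: nth_append)
qed

lemma initial_part_eq:
  assumes "x \<in> carrier GP" "I \<in> V"
  shows "initial_part V E G I x = \<iota> I (init I x)"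
  using assms
  by (auto simp: initial_part_def initial_vertex_def initial_letter_iff init_def head_def split: option.split)

lemma init_closed [simp]: "x \<in> carrier GP \<Longrightarrow> I \<in> V \<Longrightarrow> init I x \<in> carrier (G I)"
  by (simp add: init_def nf)

lemma rest_closed [simp]: "x \<in> carrier GP \<Longrightarrow> rest I x \<in> carrier GP"
  by (simp add: rest_def nf reduced_delete_first reduced_all_words)

lemma init_rest: "x \<in> carrier GP \<Longrightarrow> init I (rest I x) = \<one>\<^bsub>G I\<^esub>"
  by (simp add: rest_def init_word_value nf reduced_delete_first first_letter_delete_first head_eq_one_iff)

lemma init_mult_rest:
  assumes "x \<in> carrier GP" "I \<in> V"
  shows "\<iota> I (init I x) \<otimes>\<^bsub>GP\<^esub> rest I x = x"
  using assms nf[of x] word_value_cong[OF reduced_all_words cons_head, of "nf x" I]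
  by (simp add: init_def rest_def word_value_cons reduced_delete_first)

lemma remaining_part_eq:
  assumes "x \<in> carrier GP" "I \<in> V"
  shows "remaining_part V E G I x = rest I x"
  using assms GP.inv_solve_left[of "rest I x" "\<iota> I (init I x)" x]
  by (simp add: remaining_part_def initial_part_eq init_mult_rest)

text \<open>The means of computing both parts of a product: \<open>cons I g (nf y)\<close> is
  already reduced, so any factorisation whose second factor has trivial initial part at
  \<open>I\<close> is the canonical one.\<close>

lemma init_rest_unique:
  assumes "I \<in> V" "g \<in> carrier (G I)" "y \<in> carrier GP" "init I y = \<one>\<^bsub>G I\<^esub>"
  shows "init I (\<iota> I g \<otimes>\<^bsub>GP\<^esub> y) = g" "rest I (\<iota> I g \<otimes>\<^bsub>GP\<^esub> y) = y"
proof -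
  have y: "reduced (nf y)" "val (nf y) = y" "first_letter E I (nf y) = None"
    using assms by (simp_all add: nf init_def head_eq_one_iff)
  then have "\<iota> I g \<otimes>\<^bsub>GP\<^esub> y = val (cons I g (nf y))" "reduced (cons I g (nf y))"
    using assms by (simp_all add: word_value_cons reduced_cons)
  then show "init I (\<iota> I g \<otimes>\<^bsub>GP\<^esub> y) = g" "rest I (\<iota> I g \<otimes>\<^bsub>GP\<^esub> y) = y"
    using y by (simp_all add: init_word_value rest_word_value head_cons delete_first_cons)
qed

lemma init_one [simp]: "init I \<one>\<^bsub>GP\<^esub> = \<one>\<^bsub>G I\<^esub>"
  using init_word_value[of "[]" I] by (simp add: head_def)

lemma init_vertex_incl:
  assumes "I \<in> V" "g \<in> carrier (G I)"
  shows "init I (\<iota> I g) = g"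
  using init_rest_unique(1)[of I g "\<one>\<^bsub>GP\<^esub>"] assms by simp

lemma supp_one [simp]: "supp \<one>\<^bsub>GP\<^esub> = {}"
  using supp_word_value[of "[]"] by simp

lemma supp_eq: "x \<in> carrier GP \<Longrightarrow> supp x = fst ` set (nf x)"
  using supp_word_value[of "nf x"] nf by simp

lemma supp_rest: "x \<in> carrier GP \<Longrightarrow> supp (rest I x) \<subseteq> supp x"
  using set_delete_first_subset[of E I "nf x"]
  by (auto simp: rest_def supp_word_value reduced_delete_first nf supp_eq)

lemma init_in_supp: "x \<in> carrier GP \<Longrightarrow> init I x \<noteq> \<one>\<^bsub>G I\<^esub> \<Longrightarrow> I \<in> supp x"
  by (force simp: init_def head_def supp_eq dest: first_letter_mem split: option.splits)

lemma supp_vertex_incl_mult: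
  assumes "I \<in> V" "g \<in> carrier (G I)" "x \<in> carrier GP"
  shows "supp (\<iota> I g \<otimes>\<^bsub>GP\<^esub> x) \<subseteq> (if g = \<one>\<^bsub>G I\<^esub> then {} else {I}) \<union> supp x"
proof -
  have "supp (\<iota> I g \<otimes>\<^bsub>GP\<^esub> x) = fst ` set (act (I, g) (nf x))"
    using assms word_value_act[of "nf x" "(I, g)"] supp_word_value[of "act (I, g) (nf x)"]
    by (simp add: nf reduced_act)
  also have "\<dots> \<subseteq> insert I (supp x)"
    using assms set_delete_first_subset[of E I "nf x"] by (auto simp: act_def cons_def supp_eq)
  finally have "supp (\<iota> I g \<otimes>\<^bsub>GP\<^esub> x) \<subseteq> insert I (supp x)" .
  then show ?thesis using assms by auto
qed

lemma vertex_incl_commute_adjacent_supp: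
  assumes "I \<in> V" "g \<in> carrier (G I)" "x \<in> carrier GP" "\<forall>J\<in>supp x. adjacent E I J"
  shows "\<iota> I g \<otimes>\<^bsub>GP\<^esub> x = x \<otimes>\<^bsub>GP\<^esub> \<iota> I g"
proof -
  have "\<iota> I g \<otimes>\<^bsub>GP\<^esub> val w = val w \<otimes>\<^bsub>GP\<^esub> \<iota> I g"
    if "w \<in> all_words V G" "\<forall>y\<in>set w. adjacent E I (fst y)" for w
    using that
  proof (induction w)
    case (Cons y w)
    then have y: "\<iota> (fst y) (snd y) \<in> carrier GP" by simp
    have "\<iota> I g \<otimes>\<^bsub>GP\<^esub> val (y # w) = (\<iota> I g \<otimes>\<^bsub>GP\<^esub> \<iota> (fst y) (snd y)) \<otimes>\<^bsub>GP\<^esub> val w"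
      using assms Cons.prems y by (simp add: word_value_Cons GP.m_assoc)
    also have "\<iota> I g \<otimes>\<^bsub>GP\<^esub> \<iota> (fst y) (snd y) = \<iota> (fst y) (snd y) \<otimes>\<^bsub>GP\<^esub> \<iota> I g"
      using assms Cons.prems by (intro vertex_incl_commute) simp_all
    finally show ?case
      using assms Cons y by (simp add: word_value_Cons GP.m_assoc)
  qed (use assms in simp)
  from this[of "nf x"] show ?thesis
    using assms by (simp add: nf reduced_all_words supp_eq)
qed

end


section \<open>Least upper bounds in positive cones\<close>

text \<open>The left-invariant order in terms of the cofactor \<open>p\<close>, which is what the
  factorisation arguments manipulate; \<open>below_iff\<close> connects it with the inverse used in
  \<open>cone_order\<close>.\<close>

definition below :: "('a, 'b) monoid_scheme \<Rightarrow> 'a set \<Rightarrow> 'a \<Rightarrow> 'a \<Rightarrow> bool"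
  where "below G P x y \<longleftrightarrow> (\<exists>p\<in>P. y = x \<otimes>\<^bsub>G\<^esub> p)"

definition is_lub :: "('a, 'b) monoid_scheme \<Rightarrow> 'a set \<Rightarrow> 'a \<Rightarrow> 'a \<Rightarrow> 'a \<Rightarrow> bool"
  where "is_lub G P t x y \<longleftrightarrow> t \<in> P \<and> below G P x t \<and> below G P y t \<and>
    (\<forall>z\<in>P. below G P x z \<longrightarrow> below G P y z \<longrightarrow> below G P t z)"

lemma is_lub_least:
  "is_lub G P t x y \<Longrightarrow> z \<in> P \<Longrightarrow> below G P x z \<Longrightarrow> below G P y z \<Longrightarrow> below G P t z"
  by (simp add: is_lub_def)

context partially_ordered_group
begin

lemma cone_subset: "P \<subseteq> carrier G"
  and cone_one: "\<one> \<in> P"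
  and cone_mult: "x \<in> P \<Longrightarrow> y \<in> P \<Longrightarrow> x \<otimes> y \<in> P"
  using submonoid_cone by (auto simp: submonoid_def)

lemma cone_carrier: "x \<in> P \<Longrightarrow> x \<in> carrier G"
  using cone_subset by blast

lemma cone_mult_eq_one:
  assumes "x \<in> P" "y \<in> P" "x \<otimes> y = \<one>"
  shows "y = \<one>"
proof -
  have "inv x = y"
    using assms by (simp add: cone_carrier inv_equality inv_comm)
  then have "y \<in> P \<inter> set_inv P"
    using assms by (auto simp: SET_INV_def)
  then show ?thesis using cone_Int_inv by simp
qed

lemma below_iff: "x \<in> carrier G \<Longrightarrow> y \<in> carrier G \<Longrightarrow> below G P x y \<longleftrightarrow> inv x \<otimes> y \<in> P"
  unfolding below_def using cone_carrier by (metis inv_closed inv_solve_left m_closed)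

lemma below_refl: "x \<in> P \<Longrightarrow> below G P x x"
  unfolding below_def using cone_one cone_carrier r_one by metis

lemma below_mult: "p \<in> P \<Longrightarrow> below G P x (x \<otimes> p)"
  by (auto simp: below_def)

lemma below_one: "x \<in> P \<Longrightarrow> below G P \<one> x"
  unfolding below_def using cone_carrier by force

lemma below_trans: "x \<in> P \<Longrightarrow> below G P x y \<Longrightarrow> below G P y z \<Longrightarrow> below G P x z"
  unfolding below_def using cone_carrier cone_mult m_assoc by metis

lemma below_antisym:
  assumes "x \<in> P" "below G P x y" "below G P y x"
  shows "x = y"
proof -
  obtain p q where pq: "p \<in> P" "q \<in> P" "y = x \<otimes> p" "x = y \<otimes> q"
    using assms by (auto simp: below_def)
  then have "x \<otimes> (p \<otimes> q) = x"
    using assms by (metis cone_carrier m_assoc)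
  then have "p \<otimes> q = \<one>"
    using assms(1) pq(1,2) by (simp add: cone_carrier)
  then have "q = \<one>" using pq cone_mult_eq_one by blast
  moreover have "y \<in> P" using assms(1) pq cone_mult by blast
  ultimately show ?thesis using pq(4) cone_carrier by simp
qed

lemma Upper_cone_order_iff:
  "x \<in> P \<Longrightarrow> y \<in> P \<Longrightarrow>
    z \<in> Upper (cone_order G P) {x, y} \<longleftrightarrow> z \<in> P \<and> below G P x z \<and> below G P y z"
  by (auto simp: Upper_def cone_order_def below_iff cone_carrier)

lemma least_Upper_cone_order_iff:
  assumes "x \<in> P" "y \<in> P"
  shows "least (cone_order G P) t (Upper (cone_order G P) {x, y}) \<longleftrightarrow> is_lub G P t x y"
proof -
  have "(a \<sqsubseteq>\<^bsub>cone_order G P\<^esub> b) \<longleftrightarrow> below G P a b" if "a \<in> P" "b \<in> P" for a b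
    using that by (simp add: cone_order_def below_iff cone_carrier)
  moreover have "carrier (cone_order G P) = P" by (simp add: cone_order_def)
  ultimately show ?thesis
    unfolding least_def is_lub_def using Upper_cone_order_iff[OF assms] by auto
qed

lemma is_lub_unique: "is_lub G P s x y \<Longrightarrow> is_lub G P t x y \<Longrightarrow> s = t"
  unfolding is_lub_def using below_antisym by blast

lemma join_cone_order_eq:
  assumes "x \<in> P" "y \<in> P" "is_lub G P t x y"
  shows "x \<squnion>\<^bsub>cone_order G P\<^esub> y = t"
  unfolding join_def sup_def least_Upper_cone_order_iff[OF assms(1,2)]
  using assms(3) is_lub_unique by blast

end


section \<open>Positive elements of graph products\<close>

locale partially_ordered_family =
  fixes V :: "'v set" and E :: "'v set set" and G :: "'v \<Rightarrow> ('a, 'b) monoid_scheme"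
    and P :: "'v \<Rightarrow> 'a set"
  assumes partially_ordered_group_at: "I \<in> V \<Longrightarrow> partially_ordered_group (G I) (P I)"

sublocale partially_ordered_family \<subseteq> group_family
  by (intro group_family.intro partially_ordered_group.axioms(1)[OF partially_ordered_group_at])

context partially_ordered_family
begin

definition positive :: "('v \<times> 'a) list \<Rightarrow> bool"
  where "positive w \<longleftrightarrow> reduced w \<and> (\<forall>x\<in>set w. snd x \<in> P (fst x))"

abbreviation cone :: "('v \<times> 'a) list set set set" where "cone \<equiv> graph_product_cone V E G P"

lemma positive_reduced: "positive w \<Longrightarrow> reduced w"
  by (simp add: positive_def)

lemma positive_Nil [simp]: "positive []"
  by (simp add: positive_def)

lemma positive_Cons: "positive (x # w) \<longleftrightarrow> fst x \<in> V \<and> snd x \<in> P (fst x) - {\<one>\<^bsub>G (fst x)\<^esub>} \<and>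
    first_letter E (fst x) w = None \<and> positive w"
  using partially_ordered_group.cone_carrier[OF partially_ordered_group_at]
  by (auto simp: positive_def)

lemma cone_eq: "cone = val ` Collect positive"
  by (auto simp: graph_product_cone_def reduced_expression_iff positive_def case_prod_beta)

lemma positive_cong: "positive u \<Longrightarrow> shuffle_eq E u w \<Longrightarrow> positive w"
  unfolding positive_def using reduced_cong shuffle_eq_set by metis

lemma positive_nf: "x \<in> cone \<Longrightarrow> positive (nf x)"
  using positive_cong[OF _ shuffle_eq_sym[OF nf_word_value]] positive_reduced
  by (auto simp: cone_eq)

lemma cone_closed [simp]: "x \<in> cone \<Longrightarrow> x \<in> carrier GP"
  by (auto simp: cone_eq positive_def reduced_all_words)

lemma one_in_cone: "\<one>\<^bsub>GP\<^esub> \<in> cone"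
  unfolding cone_eq by (rule image_eqI[of _ _ "[]"]) simp_all

lemma positive_head: "positive w \<Longrightarrow> I \<in> V \<Longrightarrow> head I w \<in> P I"
  using partially_ordered_group.cone_one[OF partially_ordered_group_at]
  by (force simp: head_def positive_def dest: first_letter_mem split: option.split)

lemma positive_delete_first: "positive w \<Longrightarrow> positive (delete_first E I w)"
  using set_delete_first_subset by (fastforce simp: positive_def reduced_delete_first)

lemma positive_act:
  assumes "positive w" "fst x \<in> V" "snd x \<in> P (fst x)"
  shows "positive (act x w)"
proof -
  interpret partially_ordered_group "G (fst x)" "P (fst x)"
    using assms by (simp add: partially_ordered_group_at)
  show ?thesis
    using assms positive_head[of w "fst x"] positive_delete_first[of w "fst x"]
    by (auto simp: act_def cons_def positive_Cons cone_mult first_letter_delete_first positive_reduced)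
qed

text \<open>By \<open>cone_mult_eq_one\<close>, a product of positive elements is trivial only if
  both factors are. So a positive letter may absorb the initial letter at its vertex but is never
  cancelled by it.\<close>

lemma act_positive_eq:
  assumes "positive w" "fst x \<in> V" "snd x \<in> P (fst x)" "snd x \<noteq> \<one>\<^bsub>G (fst x)\<^esub>"
  shows "act x w = (fst x, snd x \<otimes>\<^bsub>G (fst x)\<^esub> head (fst x) w) # delete_first E (fst x) w"
proof -
  interpret partially_ordered_group "G (fst x)" "P (fst x)"
    using assms by (simp add: partially_ordered_group_at)
  have "snd x \<otimes>\<^bsub>G (fst x)\<^esub> head (fst x) w \<noteq> \<one>\<^bsub>G (fst x)\<^esub>"
    using assms positive_head[of w "fst x"] cone_mult_eq_one[of "snd x" "head (fst x) w"] cone_carrier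
    by auto
  then show ?thesis by (simp add: act_def cons_def)
qed

lemma positive_acts: "positive u \<Longrightarrow> positive w \<Longrightarrow> positive (acts u w)"
  by (induction u) (simp_all add: positive_Cons positive_act)

text \<open>The leading letter of \<open>u\<close> always leaves a letter behind, by
  \<open>act_positive_eq\<close>. That \<open>cone\<close> meets its inverse only in the identity
  rests on this.\<close>

lemma acts_positive_eq_Nil: "positive u \<Longrightarrow> positive w \<Longrightarrow> acts u w = [] \<Longrightarrow> u = []"
  by (cases u) (simp_all add: positive_Cons positive_acts act_positive_eq)

lemma word_value_acts_positive:
  "positive u \<Longrightarrow> positive w \<Longrightarrow> val (acts u w) = val u \<otimes>\<^bsub>GP\<^esub> val w"
  by (simp add: word_value_acts positive_reduced reduced_all_words)

lemma partially_ordered_group_graph_product: "partially_ordered_group GP cone"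
proof (intro partially_ordered_group.intro partially_ordered_group_axioms.intro GP.is_group)
  show "submonoid cone GP"
  proof
    fix x y assume "x \<in> cone" "y \<in> cone"
    then obtain u w where "x = val u" "positive u" "y = val w" "positive w"
      by (auto simp: cone_eq)
    then show "x \<otimes>\<^bsub>GP\<^esub> y \<in> cone"
      unfolding cone_eq using positive_acts word_value_acts_positive by (metis imageI mem_Collect_eq)
  qed (auto simp: one_in_cone)
  have "x = \<one>\<^bsub>GP\<^esub>" if xy: "x \<in> cone" "y \<in> cone" "x = inv\<^bsub>GP\<^esub> y" for x y
  proof -
    obtain u w where uw: "x = val u" "positive u" "y = val w" "positive w"
      using xy(1,2) by (auto simp: cone_eq)
    have "val (acts u w) = val []"
      using xy uw by (simp add: word_value_acts_positive)
    then have "acts u w = []"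
      using normal_form_unique[of "acts u w" "[]"] uw positive_acts positive_reduced by simp
    then show ?thesis using acts_positive_eq_Nil[of u w] uw by simp
  qed
  then have "cone \<inter> set_inv\<^bsub>GP\<^esub> cone \<subseteq> {\<one>\<^bsub>GP\<^esub>}"
    unfolding SET_INV_def by blast
  moreover have "\<one>\<^bsub>GP\<^esub> \<in> set_inv\<^bsub>GP\<^esub> cone"
    unfolding SET_INV_def by (intro UN_I[OF one_in_cone]) simp
  ultimately show "cone \<inter> set_inv\<^bsub>GP\<^esub> cone = {\<one>\<^bsub>GP\<^esub>}"
    using one_in_cone by blast
qed

sublocale GP: partially_ordered_group GP cone
  by (rule partially_ordered_group_graph_product)

section \<open>Initial and remaining parts of positive elements under the order\<close>

lemma init_in_cone: "x \<in> cone \<Longrightarrow> I \<in> V \<Longrightarrow> init I x \<in> P I"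
  by (simp add: init_def positive_nf positive_head)

lemma rest_in_cone: "x \<in> cone \<Longrightarrow> rest I x \<in> cone"
  unfolding rest_def by (subst cone_eq) (simp add: positive_nf positive_delete_first)

lemma vertex_incl_in_cone: "I \<in> V \<Longrightarrow> g \<in> P I \<Longrightarrow> \<iota> I g \<in> cone"
  using partially_ordered_group.cone_carrier[OF partially_ordered_group_at, of I g]
    positive_act[of "[]" "(I, g)"] word_value_act[of "[]" "(I, g)"]
  by (subst cone_eq) force

text \<open>Some letter not at \<open>I\<close>, preceded only by letters adjacent to \<open>I\<close>, is not adjacent to \<open>I\<close>.
  Positive elements multiplied on the right can never cancel such a letter.\<close>
primrec blocks :: "('v \<times> 'a) list \<Rightarrow> 'v \<Rightarrow> bool"
  where
    "blocks [] I \<longleftrightarrow> False"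
  | "blocks (x # w) I \<longleftrightarrow> fst x \<noteq> I \<and> (adjacent E I (fst x) \<longrightarrow> blocks w I)"

lemma blocks_first_letter: "blocks w I \<Longrightarrow> first_letter E I w = None"
  by (induction w) auto

lemma blocks_or_adjacent:
  "first_letter E I w = None \<Longrightarrow> blocks w I \<or> (\<forall>x\<in>set w. adjacent E I (fst x))"
  by (induction w) (auto split: if_splits)

text \<open>The blocking letter sits at a vertex not adjacent to \<open>I\<close>, hence not at
  \<open>J\<close>, and survives the deletion.\<close>

lemma blocks_delete_first: "adjacent E I J \<Longrightarrow> blocks w I \<Longrightarrow> blocks (delete_first E J w) I"
  by (induction w) (auto simp: adjacent_sym)

text \<open>By \<open>act_positive_eq\<close>, every letter of \<open>u\<close> puts a letter at its
  own vertex in front. If that vertex is not adjacent to \<open>I\<close>, this letter blocks;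
  otherwise the block lies deeper and survives by \<open>blocks_delete_first\<close>.\<close>

lemma blocks_acts: "positive u \<Longrightarrow> positive w \<Longrightarrow> blocks u I \<Longrightarrow> blocks (acts u w) I"
  by (induction u) (auto simp: positive_Cons act_positive_eq positive_acts blocks_delete_first)

lemma head_acts_adjacent:
  "\<forall>x\<in>set u. adjacent E I (fst x) \<Longrightarrow> head I (acts u w) = head I w"
  by (induction u) (simp_all add: head_act_adjacent)

lemma init_mult_dichotomy:
  assumes "x \<in> cone" "I \<in> V" "init I x = \<one>\<^bsub>G I\<^esub>"
  shows "(\<forall>J\<in>supp x. adjacent E I J) \<or> (\<forall>p\<in>cone. init I (x \<otimes>\<^bsub>GP\<^esub> p) = \<one>\<^bsub>G I\<^esub>)"
proof -
  have "first_letter E I (nf x) = None"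
    using assms by (simp add: init_def head_eq_one_iff nf)
  then consider "blocks (nf x) I" | "\<forall>y\<in>set (nf x). adjacent E I (fst y)"
    using blocks_or_adjacent by blast
  then show ?thesis
  proof cases
    case 1
    have "init I (x \<otimes>\<^bsub>GP\<^esub> p) = \<one>\<^bsub>G I\<^esub>" if p: "p \<in> cone" for p
    proof -
      have "x \<otimes>\<^bsub>GP\<^esub> p = val (acts (nf x) (nf p))"
        using assms p by (simp add: word_value_acts_positive positive_nf nf)
      moreover have "first_letter E I (acts (nf x) (nf p)) = None"
        using assms p 1 by (intro blocks_first_letter blocks_acts positive_nf)
      moreover have "reduced (acts (nf x) (nf p))"
        using assms p by (intro positive_reduced positive_acts positive_nf)
      ultimately show ?thesis by (simp add: init_word_value head_eq_one_iff)
    qed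
    then show ?thesis by blast
  next
    case 2
    then show ?thesis using assms by (simp add: supp_eq)
  qed
qed

lemma init_mult_adjacent:
  assumes "x \<in> cone" "p \<in> cone" "\<forall>J\<in>supp x. adjacent E I J"
  shows "init I (x \<otimes>\<^bsub>GP\<^esub> p) = init I p"
proof -
  have "x \<otimes>\<^bsub>GP\<^esub> p = val (acts (nf x) (nf p))" "reduced (acts (nf x) (nf p))"
    using assms by (simp_all add: word_value_acts_positive positive_nf nf positive_acts positive_reduced)
  then have "init I (x \<otimes>\<^bsub>GP\<^esub> p) = head I (nf p)"
    using assms by (simp add: init_word_value supp_eq head_acts_adjacent)
  then show ?thesis by (simp add: init_def)
qed

lemma below_init_rest:
  assumes "x \<in> cone" "z \<in> cone" "below GP cone x z" "I \<in> V"
  shows "below (G I) (P I) (init I x) (init I z)"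
    and "below GP cone (rest I x) (rest I z)"
    and "init I z = init I x \<or> (\<forall>J\<in>supp (rest I x). adjacent E I J)"
proof -
  interpret I: partially_ordered_group "G I" "P I"
    using assms by (simp add: partially_ordered_group_at)
  let ?a = "init I x" and ?x = "rest I x"
  have a: "?a \<in> P I" "?a \<in> carrier (G I)" "\<iota> I ?a \<in> carrier GP" and x: "?x \<in> cone" "?x \<in> carrier GP"
    using assms by (simp_all add: init_in_cone rest_in_cone)
  obtain p where p: "p \<in> cone" "z = x \<otimes>\<^bsub>GP\<^esub> p"
    using assms by (auto simp: below_def)
  then have z: "z = \<iota> I ?a \<otimes>\<^bsub>GP\<^esub> (?x \<otimes>\<^bsub>GP\<^esub> p)"
    using assms a x init_mult_rest[of x I] by (simp add: GP.m_assoc[symmetric])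
  have "(below (G I) (P I) ?a (init I z) \<and> below GP cone ?x (rest I z)) \<and>
      (init I z = ?a \<or> (\<forall>J\<in>supp ?x. adjacent E I J))"
  proof (cases "\<forall>J\<in>supp ?x. adjacent E I J")
    case True
    \<comment> \<open>\<open>?b\<close> is what \<open>p\<close> contributes at \<open>I\<close>. It
      passes \<open>?x\<close>, so \<open>z\<close> is the product of
      \<open>\<iota> I (?a \<otimes> ?b)\<close> and \<open>?x \<otimes> ?p\<close>, and
      \<open>init_rest_unique\<close> reads off both parts.\<close>
    let ?b = "init I p" and ?p = "rest I p"
    have b: "?b \<in> P I" "?b \<in> carrier (G I)" "\<iota> I ?b \<in> carrier GP" and p': "?p \<in> cone" "?p \<in> carrier GP"
      using assms p by (simp_all add: init_in_cone rest_in_cone)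
    have "?x \<otimes>\<^bsub>GP\<^esub> p = (?x \<otimes>\<^bsub>GP\<^esub> \<iota> I ?b) \<otimes>\<^bsub>GP\<^esub> ?p"
      using assms p x b p' init_mult_rest[of p I] by (simp add: GP.m_assoc)
    also have "\<dots> = (\<iota> I ?b \<otimes>\<^bsub>GP\<^esub> ?x) \<otimes>\<^bsub>GP\<^esub> ?p"
      using True assms b x by (simp add: vertex_incl_commute_adjacent_supp)
    finally have "z = \<iota> I (?a \<otimes>\<^bsub>G I\<^esub> ?b) \<otimes>\<^bsub>GP\<^esub> (?x \<otimes>\<^bsub>GP\<^esub> ?p)"
      using z assms a b x p' by (simp add: vertex_incl_mult GP.m_assoc)
    moreover have "init I (?x \<otimes>\<^bsub>GP\<^esub> ?p) = \<one>\<^bsub>G I\<^esub>"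
      using True x p p' by (simp add: init_mult_adjacent init_rest)
    ultimately have "init I z = ?a \<otimes>\<^bsub>G I\<^esub> ?b" "rest I z = ?x \<otimes>\<^bsub>GP\<^esub> ?p"
      using assms a b x p' by (simp_all add: init_rest_unique)
    then show ?thesis using True b p' I.below_mult GP.below_mult by simp
  next
    case False
    \<comment> \<open>Here \<open>?x\<close> shields \<open>I\<close> from \<open>p\<close>, so the
      initial part does not grow and \<open>p\<close> goes entirely into the remaining part.\<close>
    then have "init I (?x \<otimes>\<^bsub>GP\<^esub> p) = \<one>\<^bsub>G I\<^esub>"
      using init_mult_dichotomy[OF x(1) assms(4)] p assms by (auto simp: init_rest)
    then have "init I z = ?a" "rest I z = ?x \<otimes>\<^bsub>GP\<^esub> p"
      using z assms a x p by (simp_all add: init_rest_unique)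
    then show ?thesis using p a I.below_refl GP.below_mult by simp
  qed
  then show "below (G I) (P I) ?a (init I z)" "below GP cone ?x (rest I z)"
    "init I z = ?a \<or> (\<forall>J\<in>supp ?x. adjacent E I J)" by blast+
qed

text \<open>An upper bound \<open>z\<close> may be replaced by its initial part:
  \<open>init I z\<close> bounds \<open>g\<close> and \<open>h\<close> in the vertex group, and
  \<open>\<iota> I (init I z)\<close> lies below \<open>z\<close> because \<open>rest I z\<close> is
  positive.\<close>

lemma is_lub_vertex_incl:
  assumes "I \<in> V" "g \<in> P I" "h \<in> P I" "is_lub (G I) (P I) s g h"
  shows "is_lub GP cone (\<iota> I s) (\<iota> I g) (\<iota> I h)"
proof -
  interpret I: partially_ordered_group "G I" "P I"
    using assms by (simp add: partially_ordered_group_at)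
  have s: "s \<in> P I" "below (G I) (P I) g s" "below (G I) (P I) h s"
    using assms by (simp_all add: is_lub_def)
  have mono: "below GP cone (\<iota> I a) (\<iota> I b)" if "a \<in> P I" "below (G I) (P I) a b" for a b
    using that assms by (auto simp: below_def vertex_incl_mult I.cone_carrier
        intro!: bexI[OF _ vertex_incl_in_cone])
  have "below GP cone (\<iota> I s) z"
    if z: "z \<in> cone" "below GP cone (\<iota> I g) z" "below GP cone (\<iota> I h) z" for z
  proof -
    have "below (G I) (P I) s (init I z)"
      using assms z below_init_rest(1)[of "\<iota> I g" z I] below_init_rest(1)[of "\<iota> I h" z I]
      by (simp add: is_lub_def init_in_cone vertex_incl_in_cone init_vertex_incl I.cone_carrier)
    then have "below GP cone (\<iota> I s) (\<iota> I (init I z))" using mono s by blast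
    moreover have "below GP cone (\<iota> I (init I z)) z"
      using GP.below_mult[OF rest_in_cone[OF z(1)], of "\<iota> I (init I z)" I] assms z
      by (simp add: init_mult_rest)
    ultimately show ?thesis
      using assms s by (blast intro: GP.below_trans vertex_incl_in_cone)
  qed
  then show ?thesis
    using assms s mono by (simp add: is_lub_def vertex_incl_in_cone)
qed

lemma is_lub_mult_init_rest:
  \<comment> \<open>Each half comes down to moving an element at \<open>I\<close> past a remaining
    part: past \<open>t\<close> for leastness, where the condition on the vertices enters, and past
    \<open>rest I x\<close> or \<open>rest I y\<close> for being an upper bound, where
    \<open>z\<close> enters.\<close>
  assumes "x \<in> cone" "y \<in> cone" "z \<in> cone" "I \<in> V"
    and "below GP cone x z" "below GP cone y z"
    and s: "is_lub (G I) (P I) s (init I x) (init I y)"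
    and t: "is_lub GP cone t (rest I x) (rest I y)"
    and supp_t: "supp t \<subseteq> supp (rest I x) \<union> supp (rest I y)"
  shows "is_lub GP cone (\<iota> I s \<otimes>\<^bsub>GP\<^esub> t) x y"
proof -
  interpret I: partially_ordered_group "G I" "P I"
    using assms by (simp add: partially_ordered_group_at)
  have sP: "s \<in> P I" "s \<in> carrier (G I)" and tP: "t \<in> cone" "t \<in> carrier GP"
    using s t by (auto simp: is_lub_def I.cone_carrier)
  have least: "below GP cone (\<iota> I s \<otimes>\<^bsub>GP\<^esub> t) z'"
    if z': "z' \<in> cone" "below GP cone x z'" "below GP cone y z'" for z'
  proof -
    have z'P: "init I z' \<in> P I" "rest I z' \<in> cone"
      using z' assms by (simp_all add: init_in_cone rest_in_cone)
    have "below (G I) (P I) s (init I z')" "below GP cone t (rest I z')"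
      using is_lub_least[OF s z'P(1)] is_lub_least[OF t z'P(2)] z' assms
      by (simp_all add: below_init_rest)
    then obtain r q where r: "r \<in> P I" "init I z' = s \<otimes>\<^bsub>G I\<^esub> r" and q: "q \<in> cone" "rest I z' = t \<otimes>\<^bsub>GP\<^esub> q"
      by (auto simp: below_def)
    have rc: "r \<in> carrier (G I)" "\<iota> I r \<in> cone" "\<iota> I r \<in> carrier GP" "\<iota> I s \<in> carrier GP"
      using r sP assms by (simp_all add: I.cone_carrier vertex_incl_in_cone)
    have "\<iota> I r \<otimes>\<^bsub>GP\<^esub> t = t \<otimes>\<^bsub>GP\<^esub> \<iota> I r"
    proof (cases "\<forall>J\<in>supp t. adjacent E I J")
      case True
      then show ?thesis using assms rc tP by (simp add: vertex_incl_commute_adjacent_supp)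
    next
      case False
      \<comment> \<open>A vertex on \<open>t\<close> not adjacent to \<open>I\<close> lies on one of
        the remaining parts, so that element keeps its initial part in \<open>z'\<close>. Then
        \<open>init I z'\<close> lies below \<open>s\<close>, which leaves no room for
        \<open>r\<close>.\<close>
      then have "init I z' = init I x \<or> init I z' = init I y"
        using supp_t below_init_rest(3)[of x z' I] below_init_rest(3)[of y z' I] z' assms by blast
      then have "below (G I) (P I) (init I z') s"
        using s by (auto simp: is_lub_def)
      then have "init I z' = s"
        using \<open>below (G I) (P I) s (init I z')\<close> sP I.below_antisym by blast
      then have "r = \<one>\<^bsub>G I\<^esub>" using r rc sP by simp
      then show ?thesis using assms tP by simp
    qed
    then have "\<iota> I r \<otimes>\<^bsub>GP\<^esub> (t \<otimes>\<^bsub>GP\<^esub> q) = t \<otimes>\<^bsub>GP\<^esub> (\<iota> I r \<otimes>\<^bsub>GP\<^esub> q)"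
      using rc tP q by (simp add: GP.m_assoc[symmetric])
    then have "z' = \<iota> I s \<otimes>\<^bsub>GP\<^esub> t \<otimes>\<^bsub>GP\<^esub> (\<iota> I r \<otimes>\<^bsub>GP\<^esub> q)"
      using init_mult_rest[of z' I] z' assms r q rc sP tP
      by (simp add: vertex_incl_mult GP.m_assoc)
    then show ?thesis
      using GP.below_mult GP.cone_mult rc q by metis
  qed
  have upper: "below GP cone w (\<iota> I s \<otimes>\<^bsub>GP\<^esub> t)"
    if w: "w \<in> cone" "below GP cone w z" "below (G I) (P I) (init I w) s"
      "below GP cone (rest I w) t" for w
  proof -
    let ?a = "init I w" and ?w = "rest I w"
    have a: "?a \<in> P I" "?a \<in> carrier (G I)" "\<iota> I ?a \<in> carrier GP" and wc: "?w \<in> cone" "?w \<in> carrier GP"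
      using w assms by (simp_all add: init_in_cone rest_in_cone)
    obtain u v where u: "u \<in> P I" "s = ?a \<otimes>\<^bsub>G I\<^esub> u" and v: "v \<in> cone" "t = ?w \<otimes>\<^bsub>GP\<^esub> v"
      using w by (auto simp: below_def)
    have uc: "u \<in> carrier (G I)" "\<iota> I u \<in> cone" "\<iota> I u \<in> carrier GP"
      using u assms by (simp_all add: I.cone_carrier vertex_incl_in_cone)
    have "\<iota> I u \<otimes>\<^bsub>GP\<^esub> ?w = ?w \<otimes>\<^bsub>GP\<^esub> \<iota> I u"
    proof (cases "\<forall>J\<in>supp ?w. adjacent E I J")
      case True
      then show ?thesis using assms uc wc by (simp add: vertex_incl_commute_adjacent_supp)
    next
      case False
      \<comment> \<open>The bound \<open>z\<close> keeps the initial part of \<open>w\<close>. Since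
        \<open>s\<close> lies below \<open>init I z\<close>, antisymmetry forces \<open>u\<close> to
        be trivial.\<close>
      then have "init I z = ?a"
        using below_init_rest(3)[of w z I] w assms by blast
      moreover have "below (G I) (P I) s (init I z)"
        using is_lub_least[OF s, of "init I z"] assms by (simp add: below_init_rest init_in_cone)
      ultimately have "s = ?a"
        using w sP I.below_antisym by metis
      then have "u = \<one>\<^bsub>G I\<^esub>" using u uc a by simp
      then show ?thesis using assms wc by simp
    qed
    then have "\<iota> I u \<otimes>\<^bsub>GP\<^esub> (?w \<otimes>\<^bsub>GP\<^esub> v) = ?w \<otimes>\<^bsub>GP\<^esub> (\<iota> I u \<otimes>\<^bsub>GP\<^esub> v)"
      using uc wc v by (simp add: GP.m_assoc[symmetric])
    then have "\<iota> I s \<otimes>\<^bsub>GP\<^esub> t = (\<iota> I ?a \<otimes>\<^bsub>GP\<^esub> ?w) \<otimes>\<^bsub>GP\<^esub> (\<iota> I u \<otimes>\<^bsub>GP\<^esub> v)"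
      using u v a uc wc assms by (simp add: vertex_incl_mult GP.m_assoc)
    also have "\<dots> = w \<otimes>\<^bsub>GP\<^esub> (\<iota> I u \<otimes>\<^bsub>GP\<^esub> v)"
      using w assms by (simp add: init_mult_rest)
    finally show ?thesis
      using GP.below_mult GP.cone_mult uc v by metis
  qed
  have "\<iota> I s \<otimes>\<^bsub>GP\<^esub> t \<in> cone"
    using sP tP assms by (simp add: GP.cone_mult vertex_incl_in_cone)
  then show ?thesis
    unfolding is_lub_def using least upper assms by (auto simp: is_lub_def)
qed

end

section \<open>Existence of least upper bounds in the graph product\<close>

locale weakly_quasi_lattice_ordered_family =
  fixes V :: "'v set" and E :: "'v set set" and G :: "'v \<Rightarrow> ('a, 'b) monoid_scheme"
    and P :: "'v \<Rightarrow> 'a set"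
  assumes weakly_quasi_lattice_ordered_group_at:
    "I \<in> V \<Longrightarrow> weakly_quasi_lattice_ordered_group (G I) (P I)"

sublocale weakly_quasi_lattice_ordered_family \<subseteq> partially_ordered_family
  by (intro partially_ordered_family.intro
      weakly_quasi_lattice_ordered_group.axioms(1)[OF weakly_quasi_lattice_ordered_group_at])

context weakly_quasi_lattice_ordered_family
begin

lemma ex_is_lub_vertex:
  assumes "I \<in> V" "g \<in> P I" "h \<in> P I" "c \<in> P I" "below (G I) (P I) g c" "below (G I) (P I) h c"
  shows "\<exists>s. is_lub (G I) (P I) s g h"
proof -
  interpret weakly_quasi_lattice_ordered_group "G I" "P I"
    using assms by (simp add: weakly_quasi_lattice_ordered_group_at)
  have "c \<in> Upper (cone_order (G I) (P I)) {g, h}"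
    using assms by (simp add: Upper_cone_order_iff)
  then show ?thesis
    using ex_least_upper_bound[of g h] assms by (auto simp: least_Upper_cone_order_iff)
qed

text \<open>\<open>y\<close> and \<open>z\<close> are generalised because the induction hypothesis
  is applied to their remaining parts; its claim about \<open>supp\<close> is what
  \<open>is_lub_mult_init_rest\<close> consumes.\<close>

lemma ex_is_lub_word:
  "positive u \<Longrightarrow> y \<in> cone \<Longrightarrow> z \<in> cone \<Longrightarrow> below GP cone (val u) z \<Longrightarrow> below GP cone y z \<Longrightarrow>
    \<exists>t. is_lub GP cone t (val u) y \<and> supp t \<subseteq> supp (val u) \<union> supp y"
proof (induction u arbitrary: y z)
  case Nil
  have "is_lub GP cone y \<one>\<^bsub>GP\<^esub> y"
    using Nil by (simp add: is_lub_def GP.below_refl GP.below_one)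
  then show ?case by auto
next
  case (Cons l u)
  obtain I g where l: "l = (I, g)" by fastforce
  have I: "I \<in> V" and u: "positive u" using Cons.prems l by (simp_all add: positive_Cons)
  interpret I: partially_ordered_group "G I" "P I"
    using I by (simp add: partially_ordered_group_at)
  let ?x = "val (l # u)"
  have x: "?x \<in> cone" using Cons.prems by (auto simp: cone_eq)
  \<comment> \<open>Taking \<open>I\<close> from the leading letter makes the remaining part the
    tail of the word, so the induction hypothesis applies.\<close>
  have rest_x: "rest I ?x = val u"
    using rest_word_value[OF positive_reduced[OF Cons.prems(1)], of I] l by simp
  obtain t where t: "is_lub GP cone t (rest I ?x) (rest I y)"
      "supp t \<subseteq> supp (rest I ?x) \<union> supp (rest I y)"
    using Cons.IH[of "rest I y" "rest I z"] u Cons.prems x I below_init_rest(2)[of ?x z I]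
      below_init_rest(2)[of y z I]
    by (auto simp: rest_in_cone rest_x)
  obtain s where s: "is_lub (G I) (P I) s (init I ?x) (init I y)"
    using ex_is_lub_vertex[of I "init I ?x" "init I y" "init I z"] Cons.prems x I
      below_init_rest(1)[of ?x z I] below_init_rest(1)[of y z I]
    by (auto simp: init_in_cone)
  have lub: "is_lub GP cone (\<iota> I s \<otimes>\<^bsub>GP\<^esub> t) ?x y"
    using is_lub_mult_init_rest[of ?x y z I s t] Cons.prems x I s t by blast
  have st: "s \<in> carrier (G I)" "t \<in> carrier GP"
    using s t by (auto simp: is_lub_def I.cone_carrier)
  \<comment> \<open>If neither element has a letter at \<open>I\<close> in front, the join at
    \<open>I\<close> is trivial; so \<open>I\<close> enters the support only if it lies on
    \<open>?x\<close> or \<open>y\<close>.\<close>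
  have "s = \<one>\<^bsub>G I\<^esub>" if "init I ?x = \<one>\<^bsub>G I\<^esub>" "init I y = \<one>\<^bsub>G I\<^esub>"
    using I.is_lub_unique[of s "\<one>\<^bsub>G I\<^esub>" "\<one>\<^bsub>G I\<^esub>" "\<one>\<^bsub>G I\<^esub>"] s that
    by (simp add: is_lub_def I.cone_one I.below_refl)
  then have "I \<in> supp ?x \<union> supp y" if "s \<noteq> \<one>\<^bsub>G I\<^esub>"
    using that init_in_supp[of ?x I] init_in_supp[of y I] x Cons.prems by fastforce
  then have "supp (\<iota> I s \<otimes>\<^bsub>GP\<^esub> t) \<subseteq> supp ?x \<union> supp y"
    using supp_vertex_incl_mult[of I s t] st I t supp_rest[of ?x I] supp_rest[of y I] x Cons.prems
    by (auto split: if_splits)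
  then show ?case using lub by blast
qed

lemma ex_is_lub:
  assumes "x \<in> cone" "y \<in> cone" "z \<in> cone" "below GP cone x z" "below GP cone y z"
  shows "\<exists>t. is_lub GP cone t x y \<and> supp t \<subseteq> supp x \<union> supp y"
  using ex_is_lub_word[of "nf x" y z] assms by (simp add: positive_nf nf)

lemma weakly_quasi_lattice_ordered_group_graph_product:
  "weakly_quasi_lattice_ordered_group GP cone"
proof
  fix x y assume xy: "x \<in> cone" "y \<in> cone" "Upper (cone_order GP cone) {x, y} \<noteq> {}"
  then obtain z where "z \<in> cone" "below GP cone x z" "below GP cone y z"
    using GP.Upper_cone_order_iff[OF xy(1,2)] by blast
  then obtain t where "is_lub GP cone t x y"
    using ex_is_lub[OF xy(1,2)] by blast
  then show "\<exists>z. least (cone_order GP cone) z (Upper (cone_order GP cone) {x, y})"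
    using GP.least_Upper_cone_order_iff[OF xy(1,2)] by blast
qed

text \<open>For an arbitrary vertex no further induction is required: \<open>ex_is_lub\<close>,
  applied directly to the remaining parts, already bounds the vertices on their join.\<close>

lemma join_init_rest:
  assumes "x \<in> cone" "y \<in> cone" "I \<in> V" "Upper (cone_order GP cone) {x, y} \<noteq> {}"
  defines "L \<equiv> cone_order GP cone"
  shows "Upper L {\<iota> I (init I x), \<iota> I (init I y)} \<noteq> {}"
    and "Upper L {rest I x, rest I y} \<noteq> {}"
    and "x \<squnion>\<^bsub>L\<^esub> y = (\<iota> I (init I x) \<squnion>\<^bsub>L\<^esub> \<iota> I (init I y)) \<otimes>\<^bsub>GP\<^esub> (rest I x \<squnion>\<^bsub>L\<^esub> rest I y)"
    and "supp (rest I x \<squnion>\<^bsub>L\<^esub> rest I y) \<subseteq> supp (rest I x) \<union> supp (rest I y)"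
proof -
  have P: "init I x \<in> P I" "init I y \<in> P I" "rest I x \<in> cone" "rest I y \<in> cone"
      "\<iota> I (init I x) \<in> cone" "\<iota> I (init I y) \<in> cone"
    using assms by (simp_all add: init_in_cone rest_in_cone vertex_incl_in_cone)
  obtain z where z: "z \<in> cone" "below GP cone x z" "below GP cone y z"
    using assms(4) GP.Upper_cone_order_iff[OF assms(1,2)] by blast
  obtain t where t: "is_lub GP cone t (rest I x) (rest I y)"
      "supp t \<subseteq> supp (rest I x) \<union> supp (rest I y)"
    using ex_is_lub[of "rest I x" "rest I y" "rest I z"] assms z P
      below_init_rest(2)[of x z I] below_init_rest(2)[of y z I] by (auto simp: rest_in_cone)
  obtain s where s: "is_lub (G I) (P I) s (init I x) (init I y)"
    using ex_is_lub_vertex[of I "init I x" "init I y" "init I z"] assms z P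
      below_init_rest(1)[of x z I] below_init_rest(1)[of y z I] by (auto simp: init_in_cone)
  have \<iota>s: "is_lub GP cone (\<iota> I s) (\<iota> I (init I x)) (\<iota> I (init I y))"
    using s P assms by (intro is_lub_vertex_incl)
  show "Upper L {\<iota> I (init I x), \<iota> I (init I y)} \<noteq> {}" "Upper L {rest I x, rest I y} \<noteq> {}"
    using \<iota>s t P by (auto simp: L_def is_lub_def GP.Upper_cone_order_iff simp flip: ex_in_conv)
  have "is_lub GP cone (\<iota> I s \<otimes>\<^bsub>GP\<^esub> t) x y"
    using is_lub_mult_init_rest[of x y z I s t] assms z s t by blast
  then show "x \<squnion>\<^bsub>L\<^esub> y = (\<iota> I (init I x) \<squnion>\<^bsub>L\<^esub> \<iota> I (init I y)) \<otimes>\<^bsub>GP\<^esub> (rest I x \<squnion>\<^bsub>L\<^esub> rest I y)"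
    "supp (rest I x \<squnion>\<^bsub>L\<^esub> rest I y) \<subseteq> supp (rest I x) \<union> supp (rest I y)"
    using assms P \<iota>s t by (simp_all add: L_def GP.join_cone_order_eq)
qed

end

text \<open>The operation \<open>join\<close> is total, so its value means something only where a
  least upper bound exists. The conjuncts on membership in \<open>P\<close> and on nonempty
  \<open>Upper\<close> sets ensure this for both joins on the right-hand side.\<close>

theorem theorem5p25:
  fixes V :: "'v set"
    and E :: "'v set set"
    and GG :: "'v \<Rightarrow> ('a, 'b) monoid_scheme"
    and PP :: "'v \<Rightarrow> 'a set"
  assumes "simple_graph V E"
    and "\<And>I. I \<in> V \<Longrightarrow> weakly_quasi_lattice_ordered_group (GG I) (PP I)"
  shows "let G = graph_product V E GG;
             P = graph_product_cone V E GG PP;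
             L = cone_order G P
         in weakly_quasi_lattice_ordered_group G P \<and>
            (\<forall>x\<in>P. \<forall>y\<in>P. \<forall>I\<in>V. Upper L {x, y} \<noteq> {} \<longrightarrow>
              (let x\<^sub>I = initial_part V E GG I x; x' = remaining_part V E GG I x;
                   y\<^sub>I = initial_part V E GG I y; y' = remaining_part V E GG I y
               in x\<^sub>I \<in> P \<and> y\<^sub>I \<in> P \<and> Upper L {x\<^sub>I, y\<^sub>I} \<noteq> {} \<and>
                  x' \<in> P \<and> y' \<in> P \<and> Upper L {x', y'} \<noteq> {} \<and>
                  x \<squnion>\<^bsub>L\<^esub> y = (x\<^sub>I \<squnion>\<^bsub>L\<^esub> y\<^sub>I) \<otimes>\<^bsub>G\<^esub> (x' \<squnion>\<^bsub>L\<^esub> y') \<and>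
                  vertices_on V E GG (x' \<squnion>\<^bsub>L\<^esub> y')
                    \<subseteq> vertices_on V E GG x' \<union> vertices_on V E GG y'))"
proof -
  interpret weakly_quasi_lattice_ordered_family V E GG PP
    using assms(2) by (rule weakly_quasi_lattice_ordered_family.intro)
  show ?thesis
    unfolding Let_def
  proof (intro conjI ballI impI weakly_quasi_lattice_ordered_group_graph_product)
    fix x y I
    assume "x \<in> cone" "y \<in> cone" "I \<in> V"
    then show "initial_part V E GG I x \<in> cone" "initial_part V E GG I y \<in> cone"
      "remaining_part V E GG I x \<in> cone" "remaining_part V E GG I y \<in> cone"
      by (simp_all add: initial_part_eq remaining_part_eq init_in_cone rest_in_cone vertex_incl_in_cone)
  qed (simp_all add: initial_part_eq remaining_part_eq join_init_rest)
qed

end
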